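(* Let $\boldsymbol\kappa=(\kappa_1,\kappa_2,\kappa_3,\kappa_4)\in\mathbb C^4$ satisfy the Kostov-genericity condition: $\kappa_i\notin\mathbb Z$ for $i=1,\dots,4$, and $\pm\kappa_1\pm\kappa_2\pm\kappa_3\pm\kappa_4\notin2\mathbb Z+1$ for all choices of signs. Then the two fibrations on the moduli space $M^1_1(\boldsymbol\kappa)$ defined by $\Phi$ (the underlying quasiparabolic bundle) and by $\Upsilon$ (the apparent singularity) are strongly transversal, i.e. a generic fiber of $\Phi$ and a generic fiber of $\Upsilon$ intersect in exactly one point.
   Context: Work over $\mathbb C$; $X=\mathbb P^1$ with coordinate $x$ and $D=\{t_1,t_2,t_3,t_4\}=\{0,1,t,\infty\}$, four distinct points, $U=X-D$. $M^1_1(\boldsymbol\kappa)$ is the (fine) moduli space of triples $(E,\nabla,P_\bullet)$ where $E$ is a rank 2, degree 1 vector bundle on $X$, $\nabla:E\to E\otimes\Omega^1_X(\log D)$ a logarithmic connection, and $P_i\subset E_{t_i}$ lines such that $\mathrm{res}(\nabla,t_i)$ acts by $r_i^-$ on $P_i$ and by $r_i^+$ on $E_{t_i}/P_i$, with $$(r_i^-,r_i^+)=\left(\tfrac{\kappa_i}2,-\tfrac{\kappa_i}2\right)\ (i=1,2,3),\qquad (r_4^-,r_4^+)=\left(\tfrac{\kappa_4}2-\tfrac12,-\tfrac{\kappa_4}2-\tfrac12\right).$$ Under the genericity condition all such connections are irreducible, $E\cong B:=\mathcal O\oplus\mathcal O(1)$, and $(E,P_\bullet)$ is simple (only scalar endomorphisms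 preserve all the $P_i$). $\mathcal P$ is the non-separated scheme obtained by glueing two copies $\mathcal P^+,\mathcal P^-$ of $\mathbb P^1$ by the identity along $U$. $\Upsilon:M^1_1(\boldsymbol\kappa)\to\mathcal P$: let $L\subset E$ be the unique line subbundle of degree 1; $\nabla$ induces a nonzero $\mathcal O_X$-linear map $L\to(E/L)\otimes\Omega^1_X(\log D)$ with exactly one zero, whose position is $\Upsilon(E,\nabla,P_\bullet)$ (if it is $t_i$, the point is taken in $\mathcal P^-$ if $L_{t_i}=P_i$, in $\mathcal P^+$ otherwise). $\Phi:M^1_1(\boldsymbol\kappa)\to\mathcal P$: the map $(E,\nabla,P_\bullet)\mapsto$ isomorphism class of $(E,P_\bullet)$ in the space $\mathcal Q^{\rm simple}/\mathrm{Aut}(B)$, which is isomorphic to $\mathcal P$; here $\mathcal Q=\prod_i\mathbb P(B_{t_i})$ is the space of quasiparabolic structures on $B$ and $\mathcal Q^{\rm simple}$ its open subset of simple ones. *)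

theory Defs
  imports "HOL-Analysis.Analysis"
begin

section \<open>The base curve\<close>

datatype P1 = Aff complex | Infty

text \<open>The index type 4 has the elements 1, 2, 3 and 4, where 4 is the same element as 0.\<close>

definition marked :: "complex \<Rightarrow> 4 \<Rightarrow> P1" where
  "marked t i = (if i = 1 then Aff 0 else if i = 2 then Aff 1 else if i = 3 then Aff t else Infty)"

definition open_curve :: "complex \<Rightarrow> P1 set" where
  "open_curve t = - range (marked t)"

text \<open>The curve is covered by the charts \<open>U_0\<close> with coordinate \<open>x\<close> and \<open>U_inf\<close> with coordinate
  \<open>w = 1/x\<close>.  The sheaf of logarithmic one-forms with poles on \<open>D\<close> is freely generated by
  \<open>dx / den0(x)\<close> on \<open>U_0\<close> and by \<open>dw / deninf(w)\<close> on \<open>U_inf\<close>, and on the overlap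
  \<open>dw / deninf(w) = - x^2 dx / den0(x)\<close>.\<close>

definition den0 :: "complex \<Rightarrow> complex poly" where
  "den0 t = [:0, 1:] * [:-1, 1:] * [:-t, 1:]"

definition deninf :: "complex \<Rightarrow> complex poly" where
  "deninf t = [:0, 1:] * [:1, -1:] * [:1, -t:]"

section \<open>Vector bundles of rank two\<close>

text \<open>An algebraic vector bundle on the projective line is trivial on both charts, so one of rank 2
  is given by a transition matrix \<open>g\<close> in \<open>GL_2(C[x, 1/x])\<close>.  Here a local section is a pair of
  column vectors related by \<open>s_0 = g s_inf\<close>; the value of \<open>g\<close> at 0 is irrelevant.
  With this convention \<open>O(d)\<close> has transition function \<open>x^d\<close>.  The fibre at \<open>Aff x\<close> is
  identified with the space of column vectors by the frame on \<open>U_0\<close>, the fibre at \<open>Infty\<close> by the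
  frame on \<open>U_inf\<close>.\<close>

type_synonym transfun = "complex \<Rightarrow> complex ^ 2 ^ 2"
type_synonym polymat = "complex poly ^ 2 ^ 2"
type_synonym polyvec = "complex poly ^ 2"

definition evm :: "polymat \<Rightarrow> complex \<Rightarrow> complex ^ 2 ^ 2" where
  "evm h x = map_matrix (\<lambda>p. poly p x) h"

definition evv :: "polyvec \<Rightarrow> complex \<Rightarrow> complex ^ 2" where
  "evv v x = (\<chi> i. poly (v $ i) x)"

definition is_bundle :: "transfun \<Rightarrow> bool" where
  "is_bundle g \<longleftrightarrow>
     (\<forall>i j. \<exists>p n. \<forall>x. x \<noteq> 0 \<longrightarrow> g x $ i $ j = poly p x / x ^ n) \<and>
     (\<forall>x. x \<noteq> 0 \<longrightarrow> det (g x) \<noteq> 0)"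

definition has_degree :: "transfun \<Rightarrow> int \<Rightarrow> bool" where
  "has_degree g d \<longleftrightarrow> (\<exists>c. c \<noteq> 0 \<and> (\<forall>x. x \<noteq> 0 \<longrightarrow> det (g x) = c * x powi d))"

definition bundleB :: transfun where \<comment> \<open>the direct sum of \<open>O\<close> and \<open>O(1)\<close>\<close>
  "bundleB x = vector [vector [1, 0], vector [0, x]]"

text \<open>Morphisms are given by their polynomial matrices in the two charts.\<close>

definition bundle_hom :: "transfun \<Rightarrow> transfun \<Rightarrow> polymat \<Rightarrow> polymat \<Rightarrow> bool" where
  "bundle_hom g g' h0 hinf \<longleftrightarrow>
     (\<forall>x. x \<noteq> 0 \<longrightarrow> evm h0 x ** g x = g' x ** evm hinf (1 / x))"

fun fibre_map :: "polymat \<Rightarrow> polymat \<Rightarrow> P1 \<Rightarrow> complex ^ 2 ^ 2" where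
  "fibre_map h0 hinf (Aff x) = evm h0 x"
| "fibre_map h0 hinf Infty = evm hinf 0"

definition bundle_iso :: "transfun \<Rightarrow> transfun \<Rightarrow> polymat \<Rightarrow> polymat \<Rightarrow> bool" where
  "bundle_iso g g' h0 hinf \<longleftrightarrow>
     bundle_hom g g' h0 hinf \<and> (\<forall>p. det (fibre_map h0 hinf p) \<noteq> 0)"

text \<open>A line subbundle of degree \<open>d\<close> is given by nowhere vanishing generators in the two charts,
  normalised so that its transition function is \<open>x^d\<close>; these are unique up to a common
  nonzero constant.\<close>

definition line_subbundle :: "transfun \<Rightarrow> int \<Rightarrow> polyvec \<Rightarrow> polyvec \<Rightarrow> bool" where
  "line_subbundle g d v0 vinf \<longleftrightarrow>
     (\<forall>x. evv v0 x \<noteq> 0) \<and> (\<forall>w. evv vinf w \<noteq> 0) \<and>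
     (\<forall>x. x \<noteq> 0 \<longrightarrow> g x *v evv vinf (1 / x) = (x powi d) *s evv v0 x)"

definition cline :: "complex ^ 2 \<Rightarrow> (complex ^ 2) set" where
  "cline v = range (\<lambda>c. c *s v)"

definition is_line :: "(complex ^ 2) set \<Rightarrow> bool" where
  "is_line l \<longleftrightarrow> (\<exists>v. v \<noteq> 0 \<and> l = cline v)"

fun line_at :: "polyvec \<Rightarrow> polyvec \<Rightarrow> P1 \<Rightarrow> (complex ^ 2) set" where
  "line_at v0 vinf (Aff x) = cline (evv v0 x)"
| "line_at v0 vinf Infty = cline (evv vinf 0)"

section \<open>Quasiparabolic structures\<close>

type_synonym parstr = "(complex ^ 2) set ^ 4"

definition is_parstr :: "parstr \<Rightarrow> bool" where
  "is_parstr P \<longleftrightarrow> (\<forall>i. is_line (P $ i))"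

definition qp_isomorphic :: "complex \<Rightarrow> transfun \<Rightarrow> parstr \<Rightarrow> transfun \<Rightarrow> parstr \<Rightarrow> bool" where
  "qp_isomorphic t g P g' P' \<longleftrightarrow>
     (\<exists>h0 hinf. bundle_iso g g' h0 hinf \<and>
        (\<forall>i. (\<lambda>v. fibre_map h0 hinf (marked t i) *v v) ` (P $ i) = P' $ i))"

definition qp_simple :: "complex \<Rightarrow> transfun \<Rightarrow> parstr \<Rightarrow> bool" where
  "qp_simple t g P \<longleftrightarrow>
     (\<forall>h0 hinf. bundle_hom g g h0 hinf \<and>
        (\<forall>i. (\<lambda>v. fibre_map h0 hinf (marked t i) *v v) ` (P $ i) \<subseteq> P $ i) \<longrightarrow>
        (\<exists>c. h0 = mat [:c:] \<and> hinf = mat [:c:]))"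

definition Qsimple :: "complex \<Rightarrow> parstr set" where
  "Qsimple t = {P. is_parstr P \<and> qp_simple t bundleB P}"

definition AutB_rel :: "complex \<Rightarrow> (parstr \<times> parstr) set" where
  "AutB_rel t = {(P, P'). P \<in> Qsimple t \<and> P' \<in> Qsimple t \<and> qp_isomorphic t bundleB P bundleB P'}"

definition Qorbits :: "complex \<Rightarrow> parstr set set" where
  "Qorbits t = Qsimple t // AutB_rel t"

section \<open>The moduli space of parabolic logarithmic connections\<close>

text \<open>The connection is \<open>d + con0 dx / den0\<close> in the frame on \<open>U_0\<close> and
  \<open>d + coninf dw / deninf\<close> in the frame on \<open>U_inf\<close>.\<close>

record pconn =
  transition :: transfun
  con0 :: polymat
  coninf :: polymat
  flag :: parstr

text \<open>The gauge relation \<open>dg + A_0 g = g A_inf\<close>, multiplied by \<open>den0 / dx\<close>.\<close>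

definition con_compatible :: "complex \<Rightarrow> pconn \<Rightarrow> bool" where
  "con_compatible t X \<longleftrightarrow>
     (\<forall>x. x \<noteq> 0 \<longrightarrow>
        mat (poly (den0 t) x) ** (\<chi> i j. deriv (\<lambda>z. transition X z $ i $ j) x)
          + evm (con0 X) x ** transition X x
        = mat (- (x ^ 2)) ** (transition X x ** evm (coninf X) (1 / x)))"

fun residue_at :: "complex \<Rightarrow> pconn \<Rightarrow> P1 \<Rightarrow> complex ^ 2 ^ 2" where
  "residue_at t X (Aff x) = mat (1 / poly (pderiv (den0 t)) x) ** evm (con0 X) x"
| "residue_at t X Infty = mat (1 / poly (pderiv (deninf t)) 0) ** evm (coninf X) 0"

definition rminus :: "complex ^ 4 \<Rightarrow> 4 \<Rightarrow> complex" where
  "rminus \<kappa> i = (if i = 4 then \<kappa> $ i / 2 - 1 / 2 else \<kappa> $ i / 2)"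

definition rplus :: "complex ^ 4 \<Rightarrow> 4 \<Rightarrow> complex" where
  "rplus \<kappa> i = (if i = 4 then - (\<kappa> $ i) / 2 - 1 / 2 else - (\<kappa> $ i) / 2)"

definition pconns :: "complex \<Rightarrow> complex ^ 4 \<Rightarrow> pconn set" where
  "pconns t \<kappa> =
     {X. is_bundle (transition X) \<and> has_degree (transition X) 1 \<and> con_compatible t X \<and>
         is_parstr (flag X) \<and>
         (\<forall>i. (\<forall>v \<in> flag X $ i. residue_at t X (marked t i) *v v = rminus \<kappa> i *s v) \<and>
              (\<forall>v. residue_at t X (marked t i) *v v - rplus \<kappa> i *s v \<in> flag X $ i))}"

text \<open>The condition that \<open>h\<close> commutes with \<open>d + N dz / q\<close> and \<open>d + N' dz / q\<close> in a chart.\<close>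

definition horizontal :: "complex poly \<Rightarrow> polymat \<Rightarrow> polymat \<Rightarrow> polymat \<Rightarrow> bool" where
  "horizontal q N N' h \<longleftrightarrow> h ** N = mat q ** map_matrix pderiv h + N' ** h"

definition pconn_isomorphic :: "complex \<Rightarrow> pconn \<Rightarrow> pconn \<Rightarrow> bool" where
  "pconn_isomorphic t X Y \<longleftrightarrow>
     (\<exists>h0 hinf. bundle_iso (transition X) (transition Y) h0 hinf \<and>
        horizontal (den0 t) (con0 X) (con0 Y) h0 \<and>
        horizontal (deninf t) (coninf X) (coninf Y) hinf \<and>
        (\<forall>i. (\<lambda>v. fibre_map h0 hinf (marked t i) *v v) ` (flag X $ i) = flag Y $ i))"

definition moduli :: "complex \<Rightarrow> complex ^ 4 \<Rightarrow> pconn set set" where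
  "moduli t \<kappa> =
     pconns t \<kappa> // {(X, Y). X \<in> pconns t \<kappa> \<and> Y \<in> pconns t \<kappa> \<and> pconn_isomorphic t X Y}"

section \<open>The two fibrations\<close>

text \<open>The glued curve consists of the classes of points of two copies of the projective line.\<close>

datatype copy = Plus | Minus

definition glue :: "complex \<Rightarrow> copy \<Rightarrow> P1 \<Rightarrow> (copy \<times> P1) set" where
  "glue t s p = (if p \<in> open_curve t then {(Plus, p), (Minus, p)} else {(s, p)})"

definition glued_curve :: "complex \<Rightarrow> (copy \<times> P1) set set" where
  "glued_curve t = {glue t s p | s p. True}"

text \<open>The map from \<open>L\<close> to \<open>(E/L)\<close> tensored with the logarithmic forms, in one chart: \<open>v\<close> generates
  \<open>L\<close>, the class of a section \<open>u\<close> in \<open>E/L\<close> is identified with \<open>det(v, u)\<close>, and \<open>dz / q\<close> generates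
  the logarithmic forms.\<close>

definition second_form :: "complex poly \<Rightarrow> polymat \<Rightarrow> polyvec \<Rightarrow> complex poly" where
  "second_form q N v =
     (let u = (\<chi> i. q * pderiv (v $ i)) + N *v v in v $ 1 * u $ 2 - v $ 2 * u $ 1)"

fun second_form_zero :: "complex \<Rightarrow> pconn \<Rightarrow> polyvec \<Rightarrow> polyvec \<Rightarrow> P1 \<Rightarrow> bool" where
  "second_form_zero t X v0 vinf (Aff x) \<longleftrightarrow> poly (second_form (den0 t) (con0 X) v0) x = 0"
| "second_form_zero t X v0 vinf Infty \<longleftrightarrow> poly (second_form (deninf t) (coninf X) vinf) 0 = 0"

definition apparent :: "complex \<Rightarrow> pconn \<Rightarrow> (copy \<times> P1) set" where
  "apparent t X =
     (THE q. \<exists>v0 vinf p. line_subbundle (transition X) 1 v0 vinf \<and> second_form_zero t X v0 vinf p \<and>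
        q = glue t (if \<exists>i. p = marked t i \<and> line_at v0 vinf p = flag X $ i then Minus else Plus) p)"

definition Upsilon :: "complex \<Rightarrow> pconn set \<Rightarrow> (copy \<times> P1) set" where
  "Upsilon t m = the_elem (apparent t ` m)"

definition par_class :: "complex \<Rightarrow> pconn \<Rightarrow> parstr set" where
  "par_class t X = {P \<in> Qsimple t. qp_isomorphic t bundleB P (transition X) (flag X)}"

definition Phi :: "complex \<Rightarrow> pconn set \<Rightarrow> parstr set" where
  "Phi t m = the_elem (par_class t ` m)"

section \<open>Zariski topology and genericity\<close>

text \<open>Polynomial functions of homogeneous coordinates on the product of four projective lines
  (of lines in the fibres at the marked points) and of the projective line itself.\<close>

inductive polyfun :: "((complex ^ 2) ^ 4 \<Rightarrow> complex ^ 2 \<Rightarrow> complex) \<Rightarrow> bool" where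
  "polyfun (\<lambda>u y. c)"
| "polyfun (\<lambda>u y. u $ i $ j)"
| "polyfun (\<lambda>u y. y $ j)"
| "polyfun f \<Longrightarrow> polyfun g \<Longrightarrow> polyfun (\<lambda>u y. f u y + g u y)"
| "polyfun f \<Longrightarrow> polyfun g \<Longrightarrow> polyfun (\<lambda>u y. f u y * g u y)"

definition hom_point :: "complex ^ 2 \<Rightarrow> P1" where
  "hom_point y = (if y $ 2 = 0 then Infty else Aff (y $ 1 / y $ 2))"

text \<open>A subset of a product of projective lines is Zariski closed iff its preimage in the product of
  the punctured affine planes is; homogeneity of the equations need not be imposed.\<close>

definition zariski_open :: "(parstr \<times> P1) set \<Rightarrow> bool" where
  "zariski_open S \<longleftrightarrow>
     S \<subseteq> Collect is_parstr \<times> UNIV \<and>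
     (\<exists>F. (\<forall>f \<in> F. polyfun f) \<and>
        (\<forall>u y. (\<forall>i. u $ i \<noteq> 0) \<and> y \<noteq> 0 \<longrightarrow>
           (((\<chi> i. cline (u $ i)), hom_point y) \<in> S \<longleftrightarrow> (\<exists>f \<in> F. f u y \<noteq> 0))))"

text \<open>The product of the orbit space and the glued curve: the quotient by the automorphism group is
  an open map, also after taking products, and the two copies of the projective line
  form an open cover of the glued curve.  So a set is open iff its preimages are.\<close>

definition base_open :: "complex \<Rightarrow> (parstr set \<times> (copy \<times> P1) set) set \<Rightarrow> bool" where
  "base_open t W \<longleftrightarrow>
     W \<subseteq> Qorbits t \<times> glued_curve t \<and>
     (\<forall>s. zariski_open {(P, p). P \<in> Qsimple t \<and> (AutB_rel t `` {P}, glue t s p) \<in> W})"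

definition base_dense :: "complex \<Rightarrow> (parstr set \<times> (copy \<times> P1) set) set \<Rightarrow> bool" where
  "base_dense t W \<longleftrightarrow> (\<forall>V. base_open t V \<and> V \<noteq> {} \<longrightarrow> V \<inter> W \<noteq> {})"

definition kostov_generic :: "complex ^ 4 \<Rightarrow> bool" where
  "kostov_generic \<kappa> \<longleftrightarrow>
     (\<forall>i. \<kappa> $ i \<notin> \<int>) \<and>
     (\<forall>e :: 4 \<Rightarrow> complex. (\<forall>i. e i \<in> {1, -1}) \<longrightarrow>
        \<not> (\<exists>n :: int. (\<Sum>i\<in>UNIV. e i * \<kappa> $ i) = 2 * of_int n + 1))"

end

theory Submission
  imports Defs "HOL-Computational_Algebra.Fundamental_Theorem_Algebra"
begin

text \<open>Normalise the underlying bundle to \<open>B\<close> with the parabolic line at \<open>t_i\<close> spanned by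
  \<open>(1, p_i)\<close>.  The residue conditions at the four points express the whole connection matrix
  through its upper right entry \<open>b(x) = b0 + b1 x\<close>, and they are solvable iff \<open>b\<close>
  satisfies one inhomogeneous linear equation, whose right hand side is a multiple of
  \<open>\<kappa>_1 + \<kappa>_2 + \<kappa>_3 + \<kappa>_4 - 1\<close> and hence nonzero by genericity.  The apparent singularity is the
  zero of \<open>b\<close>, so prescribing it determines \<open>b\<close> up to a scalar, and the linear equation fixes the
  scalar as long as its left hand side does not vanish at \<open>x - y\<close>.  The latter condition cuts out the
  dense open set.\<close>

section \<open>Polynomial matrices and isomorphisms\<close>

text \<open>The linear equation is an interpolation condition. The upper left entry is a section of
  the logarithmic forms, that is of O(2): it has three coefficients, while the four residues
  prescribe four values. The lower right entry imposes nothing new, because the traces of the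
  residues already add up to minus the degree, and the lower left entry is a section of O(3), with
  exactly four coefficients. The right hand side is \<open>t * (t - 1)\<close> times the sum of the
  eigenvalues \<open>rminus\<close>. The same linear form controls the bundles: it kills the values
  of a section of O(1) at the marked points, and such sections are the off-diagonal entries of the
  automorphisms of \<open>B\<close>. So its nonvanishing at \<open>x - y\<close> depends only on the
  orbit of the flags, and it already forces simplicity. Points of the moduli space are classes of
  connections on arbitrary transition functions, hence the transport lemmas. Prescribing the value
  of \<open>Phi\<close> supplies an isomorphism with \<open>B\<close>, along which a connection can
  be pulled back.\<close>

lemma poly_eqI_punctured:
  fixes p q :: "complex poly"
  assumes "\<And>x. x \<noteq> 0 \<Longrightarrow> poly p x = poly q x"
  shows "p = q"
proof (rule ccontr)
  assume "p \<noteq> q"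
  then have "finite {x. poly (p - q) x = 0}"
    by (intro poly_roots_finite) auto
  moreover have "- {0} \<subseteq> {x. poly (p - q) x = 0}"
    using assms by auto
  ultimately have "finite (- {0::complex})"
    using finite_subset by blast
  then show False
    using infinite_UNIV_char_0[where 'a = complex] by (simp add: Compl_eq_Diff_UNIV)
qed

text \<open>Here \<open>p\<close> and \<open>q\<close> are the two chart expressions of a section of
  O(k), and the coefficient of \<open>x^k\<close> is its value at infinity. Multiplying by
  \<open>x^n\<close>, where n is the degree of \<open>q\<close>, turns the right hand side into a
  polynomial with the reversed coefficients of \<open>q\<close>, so coefficients can be
  compared.\<close>

lemma poly_reciprocal_degree:
  fixes p q :: "complex poly"
  assumes "\<And>x. x \<noteq> 0 \<Longrightarrow> poly p x = x ^ k * poly q (1 / x)"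
  shows "degree p \<le> k" and "coeff p k = poly q 0"
proof -
  define n where "n = degree q"
  have eq: "monom 1 n * p = monom 1 k * reflect_poly q"
    by (rule poly_eqI_punctured)
      (simp add: poly_monom assms poly_reflect_poly_nz n_def inverse_eq_divide)
  have "coeff (monom 1 n * p) (n + k) = coeff (monom 1 k * reflect_poly q) (n + k)"
    by (simp only: eq)
  then show "coeff p k = poly q 0"
    by (simp add: coeff_monom_mult coeff_reflect_poly n_def poly_0_coeff_0)
  show "degree p \<le> k"
  proof (rule degree_le, intro allI impI)
    fix i assume "k < i"
    have "coeff (monom 1 n * p) (n + i) = coeff (monom 1 k * reflect_poly q) (n + i)"
      by (simp only: eq)
    with \<open>k < i\<close> show "coeff p i = 0"
      by (simp add: coeff_monom_mult coeff_reflect_poly n_def split: if_splits)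
  qed
qed

lemma poly_reciprocal_const:
  fixes p q :: "complex poly"
  assumes "\<And>x. x \<noteq> 0 \<Longrightarrow> poly p x = poly q (1 / x)"
  obtains c where "p = [:c:]" "q = [:c:]"
proof -
  have "degree p \<le> 0"
    by (rule poly_reciprocal_degree) (use assms in simp)
  then obtain c where p: "p = [:c:]"
    by (metis degree_eq_zeroE le_zero_eq)
  have "q = [:c:]"
    by (rule poly_eqI_punctured) (use assms[of "1 / x" for x] p in simp)
  with p show thesis
    by (rule that)
qed

lemma matrix_mul_nth2:
  fixes A B :: "'a::semiring_1 ^ 2 ^ 2"
  shows "(A ** B) $ i $ j = A $ i $ 1 * B $ 1 $ j + A $ i $ 2 * B $ 2 $ j"
  by (simp add: matrix_matrix_mult_def sum_2)

lemma matrix_vector_nth2: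
  fixes A :: "'a::semiring_1 ^ 2 ^ 2"
  shows "(A *v v) $ i = A $ i $ 1 * v $ 1 + A $ i $ 2 * v $ 2"
  by (simp add: matrix_vector_mult_def sum_2)

lemma mat_nth: "mat c $ i $ j = (if i = j then c else 0)"
  by (simp add: mat_def)

lemmas mat2_simps = vec_eq_iff forall_2 matrix_mul_nth2 matrix_vector_nth2 mat_nth

lemma mat_commute2: "A ** mat c = mat c ** (A :: 'a::comm_ring_1 ^ 2 ^ 2)"
  by (simp add: mat2_simps mult.commute)

lemma matrix_add_rdistrib2: "(A + B) ** C = A ** C + B ** C" for A B C :: "'a::semiring_1 ^ 2 ^ 2"
  by (simp add: mat2_simps algebra_simps)

lemma evm_nth [simp]: "evm h x $ i $ j = poly (h $ i $ j) x"
  by (simp add: evm_def)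

lemma evv_nth [simp]: "evv v x $ i = poly (v $ i) x"
  by (simp add: evv_def)

lemma evm_mult: "evm (A ** B) x = evm A x ** evm B x"
  by (simp add: mat2_simps)

lemma evm_add: "evm (A + B) x = evm A x + evm B x"
  by (simp add: mat2_simps)

lemma evm_mat: "evm (mat p) x = mat (poly p x)"
  by (simp add: mat2_simps)

lemma evm_mat1 [simp]: "evm (mat 1) x = mat 1"
  by (simp add: evm_mat)

lemma evv_mult: "evv (A *v v) x = evm A x *v evv v x"
  by (simp add: mat2_simps)

lemma det_evm: "det (evm A x) = poly (det A) x"
  by (simp add: det_2)

lemma evm_eqI: "(\<And>x. x \<noteq> 0 \<Longrightarrow> evm A x = evm B x) \<Longrightarrow> A = B"
  unfolding vec_eq_iff evm_nth by (auto intro: poly_eqI_punctured)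

definition adjugate2 :: "'a::comm_ring_1 ^ 2 ^ 2 \<Rightarrow> 'a ^ 2 ^ 2" where
  "adjugate2 A = vector [vector [A $ 2 $ 2, - A $ 1 $ 2], vector [- A $ 2 $ 1, A $ 1 $ 1]]"

lemma adjugate2_mult:
  "A ** adjugate2 A = mat (det A)" "adjugate2 A ** A = mat (det A)"
  by (simp_all add: adjugate2_def mat2_simps det_2 algebra_simps)

text \<open>The determinant is a polynomial without roots, hence a nonzero constant, and dividing
  the adjugate by a constant keeps it polynomial.\<close>

lemma polymat_inverse:
  fixes h :: polymat
  assumes "\<And>x. det (evm h x) \<noteq> 0"
  obtains k where "h ** k = mat 1" "k ** h = mat 1"
proof -
  have "degree (det h) = 0"
    using alg_closed_imp_poly_has_root[of "det h"] assms by (auto simp: det_evm)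
  then obtain c where c: "det h = [:c:]"
    by (rule degree_eq_zeroE)
  have "c \<noteq> 0"
    using assms[of 0] by (simp add: det_evm c)
  then have 1: "mat [:1 / c:] ** mat (det h) = (mat 1 :: polymat)"
    by (simp add: mat2_simps c one_pCons)
  define k where "k = mat [:1 / c:] ** adjugate2 h"
  have "h ** k = mat 1"
    unfolding k_def matrix_mul_assoc mat_commute2
    by (simp add: matrix_mul_assoc[symmetric] adjugate2_mult 1)
  moreover have "k ** h = mat 1"
    unfolding k_def by (simp add: matrix_mul_assoc[symmetric] adjugate2_mult 1)
  ultimately show thesis
    by (rule that)
qed

section \<open>Composition and inversion of isomorphisms of bundles, flags and connections\<close>

lemma fibre_map_mult: "fibre_map (h0 ** k0) (hinf ** kinf) p = fibre_map h0 hinf p ** fibre_map k0 kinf p"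
  by (cases p) (simp_all add: evm_mult)

lemma fibre_map_mat1 [simp]: "fibre_map (mat 1) (mat 1) p = mat 1"
  by (cases p) simp_all

lemma bundle_hom_id: "bundle_hom g g (mat 1) (mat 1)"
  by (simp add: bundle_hom_def)

lemma bundle_hom_comp:
  assumes "bundle_hom g g' h0 hinf" and "bundle_hom g' g'' k0 kinf"
  shows "bundle_hom g g'' (k0 ** h0) (kinf ** hinf)"
  using assms unfolding bundle_hom_def evm_mult by (metis matrix_mul_assoc)

lemma bundle_iso_id: "bundle_iso g g (mat 1) (mat 1)"
  by (simp add: bundle_iso_def bundle_hom_id)

lemma bundle_iso_comp:
  assumes "bundle_iso g g' h0 hinf" and "bundle_iso g' g'' k0 kinf"
  shows "bundle_iso g g'' (k0 ** h0) (kinf ** hinf)"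
  using assms unfolding bundle_iso_def fibre_map_mult
  by (auto simp: det_mul intro: bundle_hom_comp)

text \<open>In the chart at infinity \<open>bundle_iso\<close> tests \<open>hinf\<close> only at w =
  0. Elsewhere invertibility is carried over from \<open>h0\<close> by the overlap relation, both
  transition matrices being invertible there.\<close>

lemma bundle_iso_inverse:
  assumes iso: "bundle_iso g g' h0 hinf" and "is_bundle g" "is_bundle g'"
  obtains k0 kinf where "h0 ** k0 = mat 1" "k0 ** h0 = mat 1" "hinf ** kinf = mat 1"
    "kinf ** hinf = mat 1" "bundle_iso g' g k0 kinf"
proof -
  have hom: "evm h0 x ** g x = g' x ** evm hinf (1 / x)" if "x \<noteq> 0" for x
    using iso that unfolding bundle_iso_def bundle_hom_def by blast
  have det: "det (fibre_map h0 hinf p) \<noteq> 0" for p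
    using iso unfolding bundle_iso_def by blast
  have d0: "det (evm h0 x) \<noteq> 0" for x
    using det[of "Aff x"] by simp
  have dinf: "det (evm hinf w) \<noteq> 0" for w
  proof (cases "w = 0")
    case True
    then show ?thesis
      using det[of Infty] by simp
  next
    case False
    have "det (evm h0 (1 / w)) * det (g (1 / w)) = det (g' (1 / w)) * det (evm hinf w)"
      using arg_cong[OF hom[of "1 / w"], of det] False by (simp add: det_mul)
    moreover have "det (g (1 / w)) \<noteq> 0"
      using assms(2) False unfolding is_bundle_def by simp
    ultimately show ?thesis
      using d0[of "1 / w"] by auto
  qed
  obtain k0 where k0: "h0 ** k0 = mat 1" "k0 ** h0 = mat 1"
    using polymat_inverse[OF d0] by blast
  obtain kinf where kinf: "hinf ** kinf = mat 1" "kinf ** hinf = mat 1"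
    using polymat_inverse[OF dinf] by blast
  have "bundle_hom g' g k0 kinf"
    unfolding bundle_hom_def
  proof (intro allI impI)
    fix x :: complex assume "x \<noteq> 0"
    have "evm k0 x ** g' x = evm k0 x ** g' x ** (evm hinf (1 / x) ** evm kinf (1 / x))"
      by (simp add: evm_mult[symmetric] kinf)
    also have "\<dots> = evm k0 x ** (g' x ** evm hinf (1 / x)) ** evm kinf (1 / x)"
      by (simp add: matrix_mul_assoc)
    also have "\<dots> = (evm k0 x ** evm h0 x) ** g x ** evm kinf (1 / x)"
      by (simp add: matrix_mul_assoc hom[OF \<open>x \<noteq> 0\<close>, symmetric])
    also have "\<dots> = g x ** evm kinf (1 / x)"
      by (simp add: evm_mult[symmetric] k0)
    finally show "evm k0 x ** g' x = g x ** evm kinf (1 / x)" .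
  qed
  moreover have "det (fibre_map k0 kinf p) \<noteq> 0" for p
    using arg_cong[OF fibre_map_mult[of h0 k0 hinf kinf p], of det]
    by (auto simp: k0 kinf det_mul)
  ultimately show thesis
    using k0 kinf that unfolding bundle_iso_def by blast
qed

lemma qp_isomorphic_refl: "qp_isomorphic t g P g P"
  unfolding qp_isomorphic_def using bundle_iso_id by (intro exI[of _ "mat 1"]) auto

lemma qp_isomorphic_trans:
  assumes "qp_isomorphic t g P g' P'" and "qp_isomorphic t g' P' g'' P''"
  shows "qp_isomorphic t g P g'' P''"
proof -
  obtain h0 hinf where h: "bundle_iso g g' h0 hinf"
    "\<And>i. (\<lambda>v. fibre_map h0 hinf (marked t i) *v v) ` (P $ i) = P' $ i"
    using assms(1) unfolding qp_isomorphic_def by blast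
  obtain k0 kinf where k: "bundle_iso g' g'' k0 kinf"
    "\<And>i. (\<lambda>v. fibre_map k0 kinf (marked t i) *v v) ` (P' $ i) = P'' $ i"
    using assms(2) unfolding qp_isomorphic_def by blast
  have "(\<lambda>v. fibre_map (k0 ** h0) (kinf ** hinf) (marked t i) *v v) ` (P $ i) = P'' $ i" for i
    by (simp add: k(2)[symmetric] h(2)[symmetric] image_image matrix_vector_mul_assoc
        fibre_map_mult)
  then show ?thesis
    unfolding qp_isomorphic_def using bundle_iso_comp[OF h(1) k(1)] by blast
qed

lemma fibre_map_inverse_image:
  assumes "k0 ** h0 = mat 1" "kinf ** hinf = mat 1"
    and "(\<lambda>v. fibre_map h0 hinf p *v v) ` S = T"
  shows "(\<lambda>v. fibre_map k0 kinf p *v v) ` T = S"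
  by (simp add: assms(3)[symmetric] image_image matrix_vector_mul_assoc fibre_map_mult[symmetric]
      assms(1,2))

lemma qp_isomorphic_sym:
  assumes "qp_isomorphic t g P g' P'" "is_bundle g" "is_bundle g'"
  shows "qp_isomorphic t g' P' g P"
proof -
  obtain h0 hinf where h: "bundle_iso g g' h0 hinf"
    "\<And>i. (\<lambda>v. fibre_map h0 hinf (marked t i) *v v) ` (P $ i) = P' $ i"
    using assms(1) unfolding qp_isomorphic_def by blast
  obtain k0 kinf where k: "k0 ** h0 = mat 1" "kinf ** hinf = mat 1" "bundle_iso g' g k0 kinf"
    using bundle_iso_inverse[OF h(1) assms(2,3)] by metis
  show ?thesis
    unfolding qp_isomorphic_def using k(3) fibre_map_inverse_image[OF k(1,2) h(2)] by blast
qed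

lemma pderiv_matrix_mult:
  fixes A B :: polymat
  shows "map_matrix pderiv (A ** B) = map_matrix pderiv A ** B + A ** map_matrix pderiv B"
  by (simp add: mat2_simps pderiv_add pderiv_mult algebra_simps)

lemma pderiv_mat1: "map_matrix pderiv (mat 1 :: polymat) = 0"
  by (simp add: mat2_simps)

lemma horizontal_id: "horizontal q N N (mat 1)"
  by (simp add: horizontal_def pderiv_mat1)

lemma horizontal_comp:
  assumes "horizontal q N N' h" "horizontal q N' N'' k"
  shows "horizontal q N N'' (k ** h)"
proof -
  have "k ** h ** N = k ** (mat q ** map_matrix pderiv h) + k ** N' ** h"
    using assms(1) by (simp add: horizontal_def matrix_mul_assoc[symmetric] matrix_add_ldistrib)
  also have "k ** (mat q ** map_matrix pderiv h) = mat q ** (k ** map_matrix pderiv h)"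
    by (simp add: matrix_mul_assoc mat_commute2)
  also have "k ** N' = mat q ** map_matrix pderiv k + N'' ** k"
    using assms(2) by (simp add: horizontal_def)
  finally show ?thesis
    by (simp add: horizontal_def pderiv_matrix_mult matrix_add_ldistrib matrix_add_rdistrib2
        matrix_mul_assoc algebra_simps)
qed

text \<open>Differentiating \<open>h ** k = mat 1\<close> trades the derivative of \<open>k\<close>
  for that of \<open>h\<close>; the rest is multiplication by \<open>k\<close> on both
  sides.\<close>

lemma horizontal_inverse:
  assumes "horizontal q N N' h" "h ** k = mat 1" "k ** h = mat 1"
  shows "horizontal q N' N k"
proof -
  have z: "map_matrix pderiv h ** k + h ** map_matrix pderiv k = 0"
    using pderiv_matrix_mult[of h k] by (simp add: assms(2) pderiv_mat1)
  have "N ** k = k ** (h ** N) ** k"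
    by (simp add: matrix_mul_assoc assms(3))
  also have "\<dots> = k ** (mat q ** map_matrix pderiv h) ** k + k ** N' ** (h ** k)"
    using assms(1) by (simp add: horizontal_def matrix_mul_assoc matrix_add_ldistrib matrix_add_rdistrib2)
  also have "k ** (mat q ** map_matrix pderiv h) ** k = mat q ** k ** (map_matrix pderiv h ** k)"
    by (simp add: matrix_mul_assoc mat_commute2)
  finally have "N ** k + mat q ** map_matrix pderiv k =
      mat q ** k ** (map_matrix pderiv h ** k) + k ** N' + mat q ** (k ** h) ** map_matrix pderiv k"
    by (simp add: assms)
  also have "\<dots> = mat q ** k ** (map_matrix pderiv h ** k + h ** map_matrix pderiv k) + k ** N'"
    by (simp add: matrix_mul_assoc matrix_add_ldistrib algebra_simps)
  also have "\<dots> = k ** N'"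
    by (simp add: z)
  finally show ?thesis
    by (simp add: horizontal_def algebra_simps)
qed

lemma pconn_isomorphic_refl: "pconn_isomorphic t X X"
  unfolding pconn_isomorphic_def
  by (intro exI[of _ "mat 1"] conjI bundle_iso_id horizontal_id) simp

lemma pconn_isomorphic_trans:
  assumes "pconn_isomorphic t X Y" and "pconn_isomorphic t Y Z"
  shows "pconn_isomorphic t X Z"
proof -
  obtain h0 hinf where h: "bundle_iso (transition X) (transition Y) h0 hinf"
    "horizontal (den0 t) (con0 X) (con0 Y) h0" "horizontal (deninf t) (coninf X) (coninf Y) hinf"
    "\<And>i. (\<lambda>v. fibre_map h0 hinf (marked t i) *v v) ` (flag X $ i) = flag Y $ i"
    using assms(1) unfolding pconn_isomorphic_def by blast
  obtain k0 kinf where k: "bundle_iso (transition Y) (transition Z) k0 kinf"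
    "horizontal (den0 t) (con0 Y) (con0 Z) k0" "horizontal (deninf t) (coninf Y) (coninf Z) kinf"
    "\<And>i. (\<lambda>v. fibre_map k0 kinf (marked t i) *v v) ` (flag Y $ i) = flag Z $ i"
    using assms(2) unfolding pconn_isomorphic_def by blast
  have "(\<lambda>v. fibre_map (k0 ** h0) (kinf ** hinf) (marked t i) *v v) ` (flag X $ i) = flag Z $ i"
    for i
    by (simp add: k(4)[symmetric] h(4)[symmetric] image_image matrix_vector_mul_assoc
        fibre_map_mult)
  then show ?thesis
    unfolding pconn_isomorphic_def
    using bundle_iso_comp[OF h(1) k(1)] horizontal_comp[OF h(2) k(2)] horizontal_comp[OF h(3) k(3)]
    by blast
qed

lemma pconn_isomorphic_sym:
  assumes "pconn_isomorphic t X Y" "is_bundle (transition X)" "is_bundle (transition Y)"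
  shows "pconn_isomorphic t Y X"
proof -
  obtain h0 hinf where h: "bundle_iso (transition X) (transition Y) h0 hinf"
    "horizontal (den0 t) (con0 X) (con0 Y) h0" "horizontal (deninf t) (coninf X) (coninf Y) hinf"
    "\<And>i. (\<lambda>v. fibre_map h0 hinf (marked t i) *v v) ` (flag X $ i) = flag Y $ i"
    using assms(1) unfolding pconn_isomorphic_def by blast
  obtain k0 kinf where k: "h0 ** k0 = mat 1" "k0 ** h0 = mat 1" "hinf ** kinf = mat 1"
    "kinf ** hinf = mat 1" "bundle_iso (transition Y) (transition X) k0 kinf"
    using bundle_iso_inverse[OF h(1) assms(2,3)] by metis
  show ?thesis
    unfolding pconn_isomorphic_def
    using k(5) horizontal_inverse[OF h(2) k(1,2)] horizontal_inverse[OF h(3) k(3,4)]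
      fibre_map_inverse_image[OF k(2,4) h(4)] by blast
qed

definition pconn_rel :: "complex \<Rightarrow> complex ^ 4 \<Rightarrow> (pconn \<times> pconn) set" where
  "pconn_rel t \<kappa> = {(X, Y). X \<in> pconns t \<kappa> \<and> Y \<in> pconns t \<kappa> \<and> pconn_isomorphic t X Y}"

lemma pconns_is_bundle: "X \<in> pconns t \<kappa> \<Longrightarrow> is_bundle (transition X)"
  by (simp add: pconns_def)

lemma equiv_pconn_rel: "equiv (pconns t \<kappa>) (pconn_rel t \<kappa>)"
proof (rule equivI)
  show "refl_on (pconns t \<kappa>) (pconn_rel t \<kappa>)"
    by (auto simp: refl_on_def pconn_rel_def pconn_isomorphic_refl)
  show "sym (pconn_rel t \<kappa>)"
    by (auto simp: sym_def pconn_rel_def intro: pconn_isomorphic_sym pconns_is_bundle)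
  show "trans (pconn_rel t \<kappa>)"
    by (auto simp: trans_def pconn_rel_def intro: pconn_isomorphic_trans)
qed (auto simp: pconn_rel_def)

lemma is_bundle_bundleB: "is_bundle bundleB"
proof -
  have "\<exists>p n. \<forall>x. x \<noteq> 0 \<longrightarrow> bundleB x $ i $ j = poly p x / x ^ n" for i j
    by (rule exI[of _ "if i = j then if i = 1 then 1 else [:0, 1:] else 0"], rule exI[of _ 0])
      (use exhaust_2[of i] exhaust_2[of j] in \<open>auto simp: bundleB_def\<close>)
  then show ?thesis
    by (simp add: is_bundle_def det_2 bundleB_def)
qed

lemma equiv_AutB_rel: "equiv (Qsimple t) (AutB_rel t)"
proof (rule equivI)
  show "refl_on (Qsimple t) (AutB_rel t)"
    by (auto simp: refl_on_def AutB_rel_def qp_isomorphic_refl)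
  show "sym (AutB_rel t)"
    by (auto simp: sym_def AutB_rel_def intro: qp_isomorphic_sym is_bundle_bundleB)
  show "trans (AutB_rel t)"
    by (auto simp: trans_def AutB_rel_def intro: qp_isomorphic_trans)
qed (auto simp: AutB_rel_def)

section \<open>Invariance of the two maps\<close>

text \<open>Isolating the predicate under the definite description allows its invariance to be
  proved before its solution is known to be unique.\<close>

definition apparent_rel :: "complex \<Rightarrow> pconn \<Rightarrow> (copy \<times> P1) set \<Rightarrow> bool" where
  "apparent_rel t X q \<longleftrightarrow>
     (\<exists>v0 vinf p. line_subbundle (transition X) 1 v0 vinf \<and> second_form_zero t X v0 vinf p \<and>
        q = glue t (if \<exists>i. p = marked t i \<and> line_at v0 vinf p = flag X $ i then Minus else Plus) p)"

lemma apparent_eq: "apparent t X = (THE q. apparent_rel t X q)"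
  unfolding apparent_def apparent_rel_def by (rule refl)

text \<open>Horizontality absorbs the Leibniz term of \<open>h *v v\<close>, so the covariant
  derivative of the image is the image of the covariant derivative. Since E/L is read off through
  the pairing det(v, u), what remains is the factor \<open>det h\<close>.\<close>

lemma second_form_mult:
  assumes "horizontal q N N' h"
  shows "second_form q N' (h *v v) = det h * second_form q N v"
proof -
  define u where "u = (\<chi> i. q * pderiv (v $ i)) + N *v v"
  have "(\<chi> i. q * pderiv ((h *v v) $ i)) + N' *v (h *v v) =
      (mat q ** map_matrix pderiv h + N' ** h) *v v + h *v (\<chi> i. q * pderiv (v $ i))"
    by (simp add: mat2_simps pderiv_add pderiv_mult algebra_simps)
  also have "\<dots> = (h ** N) *v v + h *v (\<chi> i. q * pderiv (v $ i))"
    using assms by (simp add: horizontal_def)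
  also have "\<dots> = h *v u"
    by (simp add: u_def mat2_simps algebra_simps)
  finally have *: "(\<chi> i. q * pderiv ((h *v v) $ i)) + N' *v (h *v v) = h *v u" .
  show ?thesis
    unfolding second_form_def * Let_def u_def[symmetric]
    by (simp add: matrix_vector_nth2 det_2 algebra_simps)
qed

lemma cline_image: "(\<lambda>v. A *v v) ` cline v = cline (A *v v)" for A :: "complex ^ 2 ^ 2"
proof -
  have "A *v (c *s v) = c *s (A *v v)" for c
    by (simp add: mat2_simps algebra_simps)
  then show ?thesis
    by (simp add: cline_def image_image)
qed

lemma line_at_image:
  "line_at (h0 *v v0) (hinf *v vinf) p = (\<lambda>v. fibre_map h0 hinf p *v v) ` line_at v0 vinf p"
  by (cases p) (simp_all add: cline_image evv_mult)

lemma fibre_map_inj: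
  assumes "k0 ** h0 = mat 1" "kinf ** hinf = mat 1"
  shows "inj (\<lambda>v. fibre_map h0 hinf p *v v)"
  by (rule inj_on_inverseI[of _ "\<lambda>v. fibre_map k0 kinf p *v v"])
    (simp add: matrix_vector_mul_assoc fibre_map_mult[symmetric] assms)

text \<open>The generators of L are transported by the isomorphism and the zero \<open>p\<close>
  stays the same. Fibre maps are injective, so L meets the flag at \<open>p\<close> before the
  transport exactly if it does so afterwards, and the choice of copy is preserved.\<close>

lemma apparent_rel_iso:
  assumes iso: "pconn_isomorphic t X Y"
    and bundles: "is_bundle (transition X)" "is_bundle (transition Y)"
    and rel: "apparent_rel t X q"
  shows "apparent_rel t Y q"
proof -
  obtain h0 hinf where h: "bundle_iso (transition X) (transition Y) h0 hinf"
    "horizontal (den0 t) (con0 X) (con0 Y) h0" "horizontal (deninf t) (coninf X) (coninf Y) hinf"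
    "\<And>i. (\<lambda>v. fibre_map h0 hinf (marked t i) *v v) ` (flag X $ i) = flag Y $ i"
    using iso unfolding pconn_isomorphic_def by blast
  obtain k0 kinf where k: "k0 ** h0 = mat 1" "kinf ** hinf = mat 1"
    using bundle_iso_inverse[OF h(1) bundles] by metis
  obtain v0 vinf p where v: "line_subbundle (transition X) 1 v0 vinf"
    "second_form_zero t X v0 vinf p"
    "q = glue t (if \<exists>i. p = marked t i \<and> line_at v0 vinf p = flag X $ i then Minus else Plus) p"
    using rel unfolding apparent_rel_def by blast
  have nz: "evm h x *v w \<noteq> 0" if "l ** h = mat 1" "w \<noteq> 0" for h l :: polymat and x w
  proof
    assume "evm h x *v w = 0"
    then have "evm (l ** h) x *v w = 0"
      by (simp add: evm_mult matrix_vector_mul_assoc[symmetric])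
    with that show False
      by simp
  qed
  have scale: "A *v (c *s w) = c *s (A *v w)" for A :: "complex ^ 2 ^ 2" and c w
    by (simp add: mat2_simps algebra_simps)
  have "transition Y x *v evv (hinf *v vinf) (1 / x) = (x powi 1) *s evv (h0 *v v0) x"
    if "x \<noteq> 0" for x
  proof -
    have "transition Y x *v evv (hinf *v vinf) (1 / x) = (evm h0 x ** transition X x) *v evv vinf (1 / x)"
      using h(1) that by (simp add: bundle_iso_def bundle_hom_def evv_mult matrix_vector_mul_assoc)
    also have "\<dots> = evm h0 x *v ((x powi 1) *s evv v0 x)"
      using v(1) that by (simp add: line_subbundle_def matrix_vector_mul_assoc[symmetric])
    finally show ?thesis
      by (simp add: scale evv_mult)
  qed
  then have "line_subbundle (transition Y) 1 (h0 *v v0) (hinf *v vinf)"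
    using v(1) unfolding line_subbundle_def by (simp add: evv_mult nz[OF k(1)] nz[OF k(2)])
  moreover have "second_form_zero t Y (h0 *v v0) (hinf *v vinf) p"
    using v(2) by (cases p) (simp_all add: second_form_mult[OF h(2)] second_form_mult[OF h(3)])
  moreover have "(line_at (h0 *v v0) (hinf *v vinf) p = flag Y $ i) =
      (line_at v0 vinf p = flag X $ i)" if "p = marked t i" for i
    unfolding line_at_image that h(4)[symmetric]
    by (rule inj_image_eq_iff[OF fibre_map_inj[OF k]])
  ultimately show ?thesis
    unfolding apparent_rel_def v(3)
    by (intro exI[of _ "h0 *v v0"] exI[of _ "hinf *v vinf"] exI[of _ p]) (auto cong: conj_cong)
qed

lemma apparent_iso:
  assumes "pconn_isomorphic t X Y" "is_bundle (transition X)" "is_bundle (transition Y)"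
  shows "apparent t X = apparent t Y"
proof -
  have "apparent_rel t X = apparent_rel t Y"
    using apparent_rel_iso[OF assms] apparent_rel_iso[OF pconn_isomorphic_sym[OF assms] assms(3,2)]
    by blast
  then show ?thesis
    by (simp add: apparent_eq)
qed

lemma par_class_iso:
  assumes "pconn_isomorphic t X Y" "is_bundle (transition X)" "is_bundle (transition Y)"
  shows "par_class t X = par_class t Y"
proof -
  have "qp_isomorphic t (transition X) (flag X) (transition Y) (flag Y)"
    using assms(1) unfolding pconn_isomorphic_def qp_isomorphic_def by blast
  moreover have "qp_isomorphic t (transition Y) (flag Y) (transition X) (flag X)"
    using calculation assms(2,3) by (rule qp_isomorphic_sym)
  ultimately show ?thesis
    unfolding par_class_def by (blast intro: qp_isomorphic_trans)
qed

section \<open>Differentiating the overlap relation of a bundle morphism\<close>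

definition deriv_matrix :: "(complex \<Rightarrow> complex ^ 2 ^ 2) \<Rightarrow> complex \<Rightarrow> complex ^ 2 ^ 2" where
  "deriv_matrix F x = (\<chi> i j. deriv (\<lambda>z. F z $ i $ j) x)"

lemma deriv_matrix_mult:
  assumes "\<And>i j. (\<lambda>z. F z $ i $ j) field_differentiable at x"
    and "\<And>i j. (\<lambda>z. G z $ i $ j) field_differentiable at x"
  shows "deriv_matrix (\<lambda>z. F z ** G z) x = deriv_matrix F x ** G x + F x ** deriv_matrix G x"
  unfolding deriv_matrix_def vec_eq_iff
  by (simp add: matrix_mul_nth2 assms field_differentiable_mult algebra_simps)

lemma deriv_matrix_evm: "deriv_matrix (evm h) x = evm (map_matrix pderiv h) x"
  by (simp add: deriv_matrix_def vec_eq_iff DERIV_imp_deriv[OF poly_DERIV])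

lemma poly_reciprocal_deriv:
  assumes "x \<noteq> 0"
  shows "((\<lambda>z. poly p (1 / z)) has_field_derivative (- (1 / x\<^sup>2) * poly (pderiv p) (1 / x))) (at x)"
proof -
  have "((\<lambda>z. 1 / z) has_field_derivative - (1 / x\<^sup>2)) (at x)"
    using assms by (auto intro!: derivative_eq_intros simp: power2_eq_square)
  from DERIV_chain2[OF poly_DERIV this] show ?thesis
    by (simp add: mult.commute)
qed

lemma deriv_matrix_evm_reciprocal:
  assumes "x \<noteq> 0"
  shows "deriv_matrix (\<lambda>z. evm h (1 / z)) x = mat (- (1 / x\<^sup>2)) ** evm (map_matrix pderiv h) (1 / x)"
  by (simp add: deriv_matrix_def mat2_simps DERIV_imp_deriv[OF poly_reciprocal_deriv[OF assms]])

lemma bundle_differentiable: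
  assumes "is_bundle g" "x \<noteq> 0"
  shows "(\<lambda>z. g z $ i $ j) field_differentiable at x"
proof -
  obtain p n where "\<And>z. z \<noteq> 0 \<Longrightarrow> g z $ i $ j = poly p z / z ^ n"
    using assms(1) unfolding is_bundle_def by blast
  note g = this
  have "(\<lambda>z. poly p z / z ^ n) field_differentiable at x"
    using assms(2) by (intro field_differentiable_divide field_differentiable_power
        field_differentiable_ident) (auto simp: field_differentiable_def intro: poly_DERIV)
  then obtain D where "((\<lambda>z. poly p z / z ^ n) has_field_derivative D) (at x)"
    unfolding field_differentiable_def by blast
  then have "((\<lambda>z. g z $ i $ j) has_field_derivative D) (at x)"
    by (rule has_field_derivative_transform_within_open[of _ _ _ "- {0}"])
      (use assms(2) g in auto)
  then show ?thesis
    unfolding field_differentiable_def by blast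
qed

lemma deriv_matrix_cong:
  assumes "\<And>z. z \<noteq> 0 \<Longrightarrow> F z = G z" "x \<noteq> 0"
  shows "deriv_matrix F x = deriv_matrix G x"
proof -
  have "eventually (\<lambda>z. F z = G z) (nhds x)"
    using t1_space_nhds[OF assms(2)] by eventually_elim (rule assms(1))
  then have "deriv (\<lambda>z. F z $ i $ j) x = deriv (\<lambda>z. G z $ i $ j) x" for i j
    by (intro deriv_cong_ev refl) (auto elim: eventually_mono)
  then show ?thesis
    by (simp add: deriv_matrix_def)
qed

section \<open>Pulling a connection back to the standard bundle\<close>

lemma poly_den0 [simp]: "poly (den0 t) x = x * (x - 1) * (x - t)"
  by (simp add: den0_def algebra_simps)

lemma poly_deninf [simp]: "poly (deninf t) w = w * (1 - w) * (1 - t * w)"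
  by (simp add: deninf_def algebra_simps)

lemma con_compatible_iff:
  "con_compatible t X \<longleftrightarrow> (\<forall>x. x \<noteq> 0 \<longrightarrow>
     mat (poly (den0 t) x) ** deriv_matrix (transition X) x + evm (con0 X) x ** transition X x
       = mat (- (x ^ 2)) ** (transition X x ** evm (coninf X) (1 / x)))"
  by (simp add: con_compatible_def deriv_matrix_def)

text \<open>Product rule on both sides of the overlap relation; the factor
  \<open>- (1 / x^2)\<close> is the derivative of w = 1/x.\<close>

lemma bundle_hom_deriv:
  assumes hom: "bundle_hom g g' h0 hinf" and "is_bundle g" "is_bundle g'" and x: "x \<noteq> 0"
  shows "evm (map_matrix pderiv h0) x ** g x + evm h0 x ** deriv_matrix g x
    = deriv_matrix g' x ** evm hinf (1 / x)
      + mat (- (1 / x\<^sup>2)) ** (g' x ** evm (map_matrix pderiv hinf) (1 / x))"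
proof -
  note g = bundle_differentiable[OF assms(2) x] bundle_differentiable[OF assms(3) x]
  have h: "(\<lambda>z. evm h0 z $ i $ j) field_differentiable at x"
    "(\<lambda>z. evm hinf (1 / z) $ i $ j) field_differentiable at x" for i j
    by (auto simp: field_differentiable_def intro: poly_DERIV poly_reciprocal_deriv[OF x])
  have "deriv_matrix (\<lambda>z. evm h0 z ** g z) x = deriv_matrix (\<lambda>z. g' z ** evm hinf (1 / z)) x"
    by (rule deriv_matrix_cong[OF _ x]) (use hom in \<open>simp add: bundle_hom_def\<close>)
  moreover have "deriv_matrix (\<lambda>z. evm h0 z ** g z) x
      = evm (map_matrix pderiv h0) x ** g x + evm h0 x ** deriv_matrix g x"
    by (simp add: deriv_matrix_mult[OF h(1) g(1)] deriv_matrix_evm)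
  moreover have "deriv_matrix (\<lambda>z. g' z ** evm hinf (1 / z)) x
      = deriv_matrix g' x ** evm hinf (1 / x)
        + g' x ** (mat (- (1 / x\<^sup>2)) ** evm (map_matrix pderiv hinf) (1 / x))"
    by (simp add: deriv_matrix_mult[OF g(2) h(2)] deriv_matrix_evm_reciprocal[OF x])
  moreover have "g' x ** (mat (- (1 / x\<^sup>2)) ** evm (map_matrix pderiv hinf) (1 / x))
      = mat (- (1 / x\<^sup>2)) ** (g' x ** evm (map_matrix pderiv hinf) (1 / x))"
    by (simp add: matrix_mul_assoc mat_commute2)
  ultimately show ?thesis
    by simp
qed

lemma mat_mult_mat: "mat a ** mat b = (mat (a * b) :: 'a::comm_ring_1 ^ 2 ^ 2)"
  by (simp add: mat2_simps)

text \<open>The gauge relation sought for \<open>Y\<close> is multiplied by \<open>evm h0 x\<close>,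
  rewritten into the one for \<open>X\<close> by horizontality in both charts and the derivative of
  the overlap relation, and \<open>evm h0 x\<close> is cancelled at the end.\<close>

lemma con_compatible_pullback:
  assumes iso: "bundle_iso (transition Y) (transition X) h0 hinf"
    and bundles: "is_bundle (transition Y)" "is_bundle (transition X)"
    and hor: "horizontal (den0 t) (con0 Y) (con0 X) h0"
      "horizontal (deninf t) (coninf Y) (coninf X) hinf"
    and X: "con_compatible t X"
  shows "con_compatible t Y"
  unfolding con_compatible_iff
proof (intro allI impI)
  fix x :: complex assume x: "x \<noteq> 0"
  define q where "q = poly (den0 t) x"
  define g where "g = transition Y x"
  define g' where "g' = transition X x"
  define H where "H = evm h0 x"
  define H' where "H' = evm (map_matrix pderiv h0) x"
  define J where "J = evm hinf (1 / x)"
  define J' where "J' = evm (map_matrix pderiv hinf) (1 / x)"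
  define A where "A = evm (con0 Y) x"
  define A' where "A' = evm (con0 X) x"
  define B where "B = evm (coninf Y) (1 / x)"
  define B' where "B' = evm (coninf X) (1 / x)"
  define G where "G = deriv_matrix (transition Y) x"
  define G' where "G' = deriv_matrix (transition X) x"
  note defs = q_def g_def g'_def H_def H'_def J_def J'_def A_def A'_def B_def B'_def G_def G'_def
  obtain k0 where "k0 ** h0 = mat 1"
    using bundle_iso_inverse[OF iso bundles] by metis
  then have K: "evm k0 x ** H = mat 1"
    by (simp add: H_def evm_mult[symmetric])
  have hg: "H ** g = g' ** J"
    using iso x by (simp add: bundle_iso_def bundle_hom_def defs)
  have dg: "H' ** g + H ** G = G' ** J + mat (- (1 / x\<^sup>2)) ** (g' ** J')"
    using bundle_hom_deriv[OF _ bundles x] iso by (simp add: bundle_iso_def defs)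
  have hA: "H ** A = mat q ** H' + A' ** H"
    using arg_cong[OF hor(1)[unfolded horizontal_def], of "\<lambda>h. evm h x"]
    by (simp add: defs evm_mult evm_add evm_mat)
  have hB: "J ** B = mat (poly (deninf t) (1 / x)) ** J' + B' ** J"
    using arg_cong[OF hor(2)[unfolded horizontal_def], of "\<lambda>h. evm h (1 / x)"]
    by (simp add: defs evm_mult evm_add evm_mat del: poly_deninf)
  \<comment> \<open>The change of generator of the logarithmic forms: \<open>den0\<close> at x
    equals x^4 times \<open>deninf\<close> at 1/x.\<close>
  have qinf: "q * (- (1 / x\<^sup>2)) = - (x\<^sup>2) * poly (deninf t) (1 / x)"
    using x by (simp add: q_def field_simps power2_eq_square)
  have X: "mat q ** G' + A' ** g' = mat (- (x\<^sup>2)) ** (g' ** B')"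
    using X x unfolding con_compatible_iff by (simp add: defs)
  have "H ** (mat q ** G + A ** g) = mat q ** (H' ** g + H ** G) + A' ** (H ** g)"
    by (simp add: matrix_add_ldistrib matrix_mul_assoc mat_commute2 hA matrix_add_rdistrib2
        algebra_simps)
  also have "\<dots> = (mat q ** G' + A' ** g') ** J + mat q ** mat (- (1 / x\<^sup>2)) ** (g' ** J')"
    by (simp add: dg hg matrix_add_ldistrib matrix_mul_assoc matrix_add_rdistrib2 algebra_simps)
  also have "\<dots> = mat (- (x\<^sup>2)) ** (g' ** (B' ** J))
      + mat (- (x\<^sup>2)) ** (mat (poly (deninf t) (1 / x)) ** (g' ** J'))"
    unfolding X mat_mult_mat qinf matrix_mul_assoc by (rule refl)
  also have "mat (poly (deninf t) (1 / x)) ** (g' ** J') = g' ** (mat (poly (deninf t) (1 / x)) ** J')"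
    by (simp add: matrix_mul_assoc mat_commute2 del: poly_deninf)
  also have "mat (- (x\<^sup>2)) ** (g' ** (B' ** J))
      + mat (- (x\<^sup>2)) ** (g' ** (mat (poly (deninf t) (1 / x)) ** J')) = mat (- (x\<^sup>2)) ** (g' ** (J ** B))"
    unfolding hB by (simp add: matrix_add_ldistrib algebra_simps del: poly_deninf)
  also have "\<dots> = H ** (mat (- (x\<^sup>2)) ** (g ** B))"
    by (simp add: matrix_mul_assoc hg[symmetric] mat_commute2)
  finally have "evm k0 x ** H ** (mat q ** G + A ** g) = evm k0 x ** H ** (mat (- (x\<^sup>2)) ** (g ** B))"
    by (simp add: matrix_mul_assoc[symmetric])
  then have "mat q ** G + A ** g = mat (- (x\<^sup>2)) ** (g ** B)"
    by (simp add: K)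
  then show "mat (poly (den0 t) x) ** deriv_matrix (transition Y) x + evm (con0 Y) x ** transition Y x
       = mat (- (x ^ 2)) ** (transition Y x ** evm (coninf Y) (1 / x))"
    by (simp add: defs)
qed

text \<open>At a marked point the denominator vanishes, so the derivative term of the gauge relation
  drops out and the residues are simply conjugate.\<close>

lemma residue_at_intertwine:
  assumes "horizontal (den0 t) (con0 Y) (con0 X) h0" "horizontal (deninf t) (coninf Y) (coninf X) hinf"
  shows "fibre_map h0 hinf (marked t i) ** residue_at t Y (marked t i)
    = residue_at t X (marked t i) ** fibre_map h0 hinf (marked t i)"
proof -
  have *: "evm h x ** (mat c ** evm N x) = mat c ** evm N' x ** evm h x"
    if "horizontal q N N' h" "poly q x = 0" for q N N' h x c
  proof -
    have "evm h x ** evm N x = evm N' x ** evm h x"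
      using arg_cong[OF that(1)[unfolded horizontal_def], of "\<lambda>h. evm h x"] that(2)
      by (simp add: evm_mult evm_add evm_mat)
    then show ?thesis
      by (metis mat_commute2 matrix_mul_assoc)
  qed
  show ?thesis
    using exhaust_4[of i] *[OF assms(1)] *[OF assms(2)]
    by (auto simp: marked_def)
qed

lemma has_degree_bundleB: "has_degree bundleB 1"
  unfolding has_degree_def by (intro exI[of _ 1]) (simp add: bundleB_def det_2)

lemma pconns_pullback:
  assumes X: "X \<in> pconns t \<kappa>" and P: "is_parstr P"
    and iso: "qp_isomorphic t bundleB P (transition X) (flag X)"
  obtains Y where "Y \<in> pconns t \<kappa>" "transition Y = bundleB" "flag Y = P" "pconn_isomorphic t Y X"
proof -
  obtain h0 hinf where h: "bundle_iso bundleB (transition X) h0 hinf"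
    "\<And>i. (\<lambda>v. fibre_map h0 hinf (marked t i) *v v) ` (P $ i) = flag X $ i"
    using iso unfolding qp_isomorphic_def by blast
  have bX: "is_bundle (transition X)"
    using X by (rule pconns_is_bundle)
  obtain k0 kinf where k: "h0 ** k0 = mat 1" "k0 ** h0 = mat 1" "hinf ** kinf = mat 1"
    "kinf ** hinf = mat 1"
    using bundle_iso_inverse[OF h(1) is_bundle_bundleB bX] by metis
  \<comment> \<open>Both connection matrices come from solving the horizontality condition for the
    source connection.\<close>
  define Y where "Y = \<lparr>transition = bundleB,
    con0 = k0 ** (mat (den0 t) ** map_matrix pderiv h0 + con0 X ** h0),
    coninf = kinf ** (mat (deninf t) ** map_matrix pderiv hinf + coninf X ** hinf), flag = P\<rparr>"
  have Y [simp]: "transition Y = bundleB" "flag Y = P"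
    by (simp_all add: Y_def)
  have hor: "horizontal (den0 t) (con0 Y) (con0 X) h0"
    "horizontal (deninf t) (coninf Y) (coninf X) hinf"
    by (simp_all add: Y_def horizontal_def matrix_mul_assoc k)
  have "con_compatible t Y"
    using con_compatible_pullback[OF _ _ bX hor] h(1) X is_bundle_bundleB by (simp add: pconns_def)
  moreover have "residue_at t Y (marked t i) *v v = rminus \<kappa> i *s v" if "v \<in> P $ i" for i v
  proof (rule injD[OF fibre_map_inj[OF k(2,4)]])
    have "fibre_map h0 hinf (marked t i) *v v \<in> flag X $ i"
      using that h(2) by blast
    then have "residue_at t X (marked t i) *v (fibre_map h0 hinf (marked t i) *v v)
        = rminus \<kappa> i *s (fibre_map h0 hinf (marked t i) *v v)"
      using X by (simp add: pconns_def)
    then show "fibre_map h0 hinf (marked t i) *v (residue_at t Y (marked t i) *v v)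
        = fibre_map h0 hinf (marked t i) *v (rminus \<kappa> i *s v)"
      by (simp add: matrix_vector_mul_assoc residue_at_intertwine[OF hor] vec.scale)
  qed
  moreover have "residue_at t Y (marked t i) *v v - rplus \<kappa> i *s v \<in> P $ i" for i v
  proof -
    have "residue_at t X (marked t i) *v (fibre_map h0 hinf (marked t i) *v v)
        - rplus \<kappa> i *s (fibre_map h0 hinf (marked t i) *v v) \<in> flag X $ i"
      using X by (simp add: pconns_def)
    also have "residue_at t X (marked t i) *v (fibre_map h0 hinf (marked t i) *v v)
        - rplus \<kappa> i *s (fibre_map h0 hinf (marked t i) *v v)
      = fibre_map h0 hinf (marked t i) *v (residue_at t Y (marked t i) *v v - rplus \<kappa> i *s v)"
      by (simp add: vec.diff matrix_vector_mul_assoc residue_at_intertwine[OF hor] vec.scale)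
    finally show ?thesis
      unfolding h(2)[symmetric] inj_image_mem_iff[OF fibre_map_inj[OF k(2,4)]] .
  qed
  ultimately have "Y \<in> pconns t \<kappa>"
    using P by (simp add: pconns_def is_bundle_bundleB has_degree_bundleB)
  moreover have "pconn_isomorphic t Y X"
    unfolding pconn_isomorphic_def using h hor by auto
  ultimately show thesis
    using that Y by blast
qed

section \<open>Connections on the standard bundle\<close>

text \<open>An affine chart of the space of flags: the one line it omits in each fibre, spanned by
  (0, 1), is the fibre of the summand O(1).\<close>

definition affine_flags :: "(4 \<Rightarrow> complex) \<Rightarrow> parstr" where
  "affine_flags p = (\<chi> i. cline (vector [1, p i]))"

lemma mem_cline_affine: "w \<in> cline (vector [1, p]) \<longleftrightarrow> w $ 2 = p * w $ 1"
proof -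
  have "w $ 2 = p * w $ 1 \<Longrightarrow> w = w $ 1 *s vector [1, p]"
    by (simp add: vec_eq_iff forall_2)
  then show ?thesis
    by (auto simp: cline_def)
qed

lemma is_parstr_affine_flags: "is_parstr (affine_flags p)"
proof -
  have "(vector [1, z] :: complex ^ 2) \<noteq> 0" for z
    by (simp add: vec_eq_iff forall_2)
  then show ?thesis
    by (auto simp: is_parstr_def is_line_def affine_flags_def)
qed

text \<open>A matrix with prescribed eigenline and prescribed eigenvalues on the line and on the
  quotient has one free parameter, here taken to be the upper right entry. The test vectors (1, p)
  and (0, 1) form a basis, so they extract all the conditions.\<close>

lemma residue_affine_flag_iff:
  fixes R :: "complex ^ 2 ^ 2"
  shows "(\<forall>v \<in> cline (vector [1, p]). R *v v = r *s v) \<and> (\<forall>v. R *v v - s *s v \<in> cline (vector [1, p]))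
    \<longleftrightarrow> R $ 1 $ 1 = r - R $ 1 $ 2 * p \<and> R $ 2 $ 1 = (r - s - R $ 1 $ 2 * p) * p \<and>
        R $ 2 $ 2 = s + R $ 1 $ 2 * p"
    (is "?L \<longleftrightarrow> ?R")
proof
  assume L: ?L
  have "R *v vector [1, p] = r *s vector [1, p]"
    using L by (auto simp: mem_cline_affine)
  moreover have "R *v vector [0, 1] - s *s vector [0, 1] \<in> cline (vector [1, p])"
    using L by blast
  ultimately show ?R
    by (simp add: mem_cline_affine mat2_simps) (auto simp: algebra_simps)
next
  assume ?R
  then show ?L
    by (simp add: mem_cline_affine mat2_simps) (simp add: algebra_simps)
qed

lemma deriv_matrix_bundleB: "deriv_matrix bundleB x = vector [vector [0, 0], vector [0, 1]]"
  by (simp add: deriv_matrix_def bundleB_def vec_eq_iff forall_2)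

lemma con_compatible_bundleB:
  assumes "transition X = bundleB"
  shows "con_compatible t X \<longleftrightarrow> (\<forall>x. x \<noteq> 0 \<longrightarrow>
    poly (con0 X $ 1 $ 1) x = - (x ^ 2) * poly (coninf X $ 1 $ 1) (1 / x) \<and>
    x * poly (con0 X $ 1 $ 2) x = - (x ^ 2) * poly (coninf X $ 1 $ 2) (1 / x) \<and>
    poly (con0 X $ 2 $ 1) x = - (x ^ 3) * poly (coninf X $ 2 $ 1) (1 / x) \<and>
    poly (den0 t) x + x * poly (con0 X $ 2 $ 2) x = - (x ^ 3) * poly (coninf X $ 2 $ 2) (1 / x))"
  unfolding con_compatible_iff assms deriv_matrix_bundleB
  by (simp add: mat2_simps bundleB_def mult.commute mult.assoc mult.left_commute conj_ac
      power2_eq_square power3_eq_cube del: poly_den0)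

text \<open>The logarithmic forms being O(2), the first three entries are sections of O(2), O(1) and
  O(3), and leading coefficients are values at infinity up to sign. The lower right entry is a
  connection on O(1) instead: differentiating the transition function x adds \<open>den0\<close>,
  whose leading coefficient is the extra 1.\<close>

lemma con_compatible_bundleB_degree:
  assumes "transition X = bundleB" "con_compatible t X"
  shows "degree (con0 X $ 1 $ 1) \<le> 2" "coeff (con0 X $ 1 $ 1) 2 = - poly (coninf X $ 1 $ 1) 0"
    "degree (con0 X $ 1 $ 2) \<le> 1" "coeff (con0 X $ 1 $ 2) 1 = - poly (coninf X $ 1 $ 2) 0"
    "degree (con0 X $ 2 $ 1) \<le> 3" "coeff (con0 X $ 2 $ 1) 3 = - poly (coninf X $ 2 $ 1) 0"
    "degree (con0 X $ 2 $ 2) \<le> 2" "1 + coeff (con0 X $ 2 $ 2) 2 = - poly (coninf X $ 2 $ 2) 0"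
proof -
  note compat = assms(2)[unfolded con_compatible_bundleB[OF assms(1)], rule_format]
  note r = poly_reciprocal_degree
  show "degree (con0 X $ 1 $ 1) \<le> 2" "coeff (con0 X $ 1 $ 1) 2 = - poly (coninf X $ 1 $ 1) 0"
    using r[of "con0 X $ 1 $ 1" 2 "- (coninf X $ 1 $ 1)"] compat by auto
  show "degree (con0 X $ 2 $ 1) \<le> 3" "coeff (con0 X $ 2 $ 1) 3 = - poly (coninf X $ 2 $ 1) 0"
    using r[of "con0 X $ 2 $ 1" 3 "- (coninf X $ 2 $ 1)"] compat by auto
  have "degree (pCons 0 (con0 X $ 1 $ 2)) \<le> 2"
    and "coeff (pCons 0 (con0 X $ 1 $ 2)) 2 = - poly (coninf X $ 1 $ 2) 0"
    using r[of "pCons 0 (con0 X $ 1 $ 2)" 2 "- (coninf X $ 1 $ 2)"] compat by auto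
  then show "degree (con0 X $ 1 $ 2) \<le> 1" "coeff (con0 X $ 1 $ 2) 1 = - poly (coninf X $ 1 $ 2) 0"
    by (auto simp: degree_pCons_eq_if coeff_pCons numeral_2_eq_2 split: if_splits)
  have "degree (den0 t + pCons 0 (con0 X $ 2 $ 2)) \<le> 3"
    and *: "coeff (den0 t + pCons 0 (con0 X $ 2 $ 2)) 3 = - poly (coninf X $ 2 $ 2) 0"
    using r[of "den0 t + pCons 0 (con0 X $ 2 $ 2)" 3 "- (coninf X $ 2 $ 2)"] compat by auto
  moreover have "degree (den0 t) \<le> 3"
    unfolding den0_def by (simp add: degree_pCons_eq_if)
  ultimately have "degree (den0 t + pCons 0 (con0 X $ 2 $ 2) - den0 t) \<le> 3"
    by (intro degree_diff_le)
  then show "degree (con0 X $ 2 $ 2) \<le> 2"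
    by (auto simp: degree_pCons_eq_if split: if_splits)
  show "1 + coeff (con0 X $ 2 $ 2) 2 = - poly (coninf X $ 2 $ 2) 0"
    using * by (simp add: den0_def coeff_pCons numeral_3_eq_3 numeral_2_eq_2)
qed

text \<open>The residue conditions at \<open>0\<close>, \<open>1\<close> and \<open>t\<close>, multiplied by \<open>d = den0'\<close> at the point,
  for the flag spanned by \<open>(1, p)\<close>.\<close>

definition finite_residue :: "complex \<Rightarrow> complex \<Rightarrow> complex \<Rightarrow> complex ^ 2 ^ 2 \<Rightarrow> bool" where
  "finite_residue d k p A \<longleftrightarrow> A $ 1 $ 1 = d * k / 2 - A $ 1 $ 2 * p \<and>
     A $ 2 $ 1 = (d * k - A $ 1 $ 2 * p) * p \<and> A $ 2 $ 2 = A $ 1 $ 2 * p - d * k / 2"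

text \<open>No factor appears, because \<open>deninf\<close> has derivative 1 at w = 0. The two
  eigenvalues still differ by \<open>k\<close>, but their sum is -1, which accounts for the degree
  of the bundle.\<close>

definition infinite_residue :: "complex \<Rightarrow> complex \<Rightarrow> complex ^ 2 ^ 2 \<Rightarrow> bool" where
  "infinite_residue k p A \<longleftrightarrow> A $ 1 $ 1 = k / 2 - 1 / 2 - A $ 1 $ 2 * p \<and>
     A $ 2 $ 1 = (k - A $ 1 $ 2 * p) * p \<and> A $ 2 $ 2 = A $ 1 $ 2 * p - k / 2 - 1 / 2"

lemma finite_residue_iff:
  assumes "d \<noteq> 0"
  shows "finite_residue d k p A \<longleftrightarrow>
    (\<forall>v \<in> cline (vector [1, p]). (mat (1 / d) ** A) *v v = (k / 2) *s v) \<and>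
    (\<forall>v. (mat (1 / d) ** A) *v v - (- k / 2) *s v \<in> cline (vector [1, p]))"
  unfolding residue_affine_flag_iff finite_residue_def
  using assms by (simp add: mat2_simps field_simps)

lemma pderiv_den0:
  "poly (pderiv (den0 t)) 0 = t" "poly (pderiv (den0 t)) 1 = 1 - t"
  "poly (pderiv (den0 t)) t = t * (t - 1)"
  by (simp_all add: den0_def pderiv_mult pderiv_pCons algebra_simps)

lemma pderiv_deninf: "poly (pderiv (deninf t)) 0 = 1"
  by (simp add: deninf_def pderiv_mult pderiv_pCons algebra_simps)

lemma marked_simps: "marked t 1 = Aff 0" "marked t 2 = Aff 1" "marked t 3 = Aff t" "marked t 4 = Infty"
  by (simp_all add: marked_def)

lemma pconns_bundleB_iff:
  assumes t: "t \<noteq> 0" "t \<noteq> 1" and X: "transition X = bundleB" "flag X = affine_flags p"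
  shows "X \<in> pconns t \<kappa> \<longleftrightarrow> con_compatible t X \<and>
    finite_residue t (\<kappa> $ 1) (p 1) (evm (con0 X) 0) \<and>
    finite_residue (1 - t) (\<kappa> $ 2) (p 2) (evm (con0 X) 1) \<and>
    finite_residue (t * (t - 1)) (\<kappa> $ 3) (p 3) (evm (con0 X) t) \<and>
    infinite_residue (\<kappa> $ 4) (p 4) (evm (coninf X) 0)"
proof -
  have "infinite_residue k p A \<longleftrightarrow>
    (\<forall>v \<in> cline (vector [1, p]). (mat 1 ** A) *v v = (k / 2 - 1 / 2) *s v) \<and>
    (\<forall>v. (mat 1 ** A) *v v - (- k / 2 - 1 / 2) *s v \<in> cline (vector [1, p]))" for k p A
    unfolding residue_affine_flag_iff infinite_residue_def by (auto simp: algebra_simps)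
  then show ?thesis
    using t is_parstr_affine_flags[of p] is_bundle_bundleB has_degree_bundleB
    unfolding pconns_def
    by (simp add: X forall_4 marked_simps rminus_def rplus_def affine_flags_def finite_residue_iff
        pderiv_den0 pderiv_deninf del: matrix_mul_lid)
qed

lemma poly_eq_linear: "degree p \<le> 1 \<Longrightarrow> p = [:coeff p 0, coeff p 1:]"
  by (rule poly_eqI) (auto simp: coeff_pCons coeff_eq_0 numeral_2_eq_2 split: nat.split)

lemma poly_eq_quadratic: "degree p \<le> 2 \<Longrightarrow> p = [:coeff p 0, coeff p 1, coeff p 2:]"
  by (rule poly_eqI) (auto simp: coeff_pCons coeff_eq_0 numeral_2_eq_2 split: nat.split)

text \<open>Up to the factor \<open>t (t - 1)\<close>, this is the sum of \<open>b(t_i) p_i / den0'(t_i)\<close> over the finite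
  marked points minus \<open>b1 p_4\<close>, where \<open>b(x) = b0 + b1 x\<close>.\<close>

definition parabolic_form :: "complex \<Rightarrow> (4 \<Rightarrow> complex) \<Rightarrow> complex \<Rightarrow> complex \<Rightarrow> complex" where
  "parabolic_form t p b0 b1 =
     (t - 1) * b0 * p 1 - t * (b0 + b1) * p 2 + (b0 + b1 * t) * p 3 - t * (t - 1) * b1 * p 4"

text \<open>Lagrange interpolation at 0, 1 and \<open>t\<close>: the leading coefficient is the sum
  of the values divided by \<open>den0'\<close>, here multiplied by
  \<open>t * (t - 1)\<close>.\<close>

lemma quadratic_lead_coeff:
  fixes a :: "complex poly"
  assumes "degree a \<le> 2"
  shows "(t - 1) * poly a 0 - t * poly a 1 + poly a t = t * (t - 1) * coeff a 2"
  by (subst (1 2 3) poly_eq_quadratic[OF assms]) (simp add: algebra_simps)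

text \<open>The values demanded by the four residues are inserted into the interpolation relation,
  and the exponents are separated from the flags. Necessity and sufficiency of the linear equation
  both rest on it.\<close>

lemma parabolic_form_identity:
  fixes t :: complex
  shows "(t - 1) * (t * k1 / 2 - b0 * p1) - t * ((1 - t) * k2 / 2 - (b0 + b1) * p2)
      + (t * (t - 1) * k3 / 2 - (b0 + b1 * t) * p3) - t * (t - 1) * - (k4 / 2 - 1 / 2 + b1 * p4)
    = t * (t - 1) * ((k1 + k2 + k3 + k4) - 1) / 2
      - ((t - 1) * b0 * p1 - t * (b0 + b1) * p2 + (b0 + b1 * t) * p3 - t * (t - 1) * b1 * p4)"
  by (simp add: field_simps)

text \<open>The Fuchs-type relation: the upper left entry has degree at most 2, so its values at
  \<open>0\<close>, \<open>1\<close>, \<open>t\<close> determine its leading coefficient, which is prescribed by the residue at infinity.\<close>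

lemma parabolic_form_con0:
  assumes t: "t \<noteq> 0" "t \<noteq> 1" and X: "transition X = bundleB" "flag X = affine_flags p"
    and "X \<in> pconns t \<kappa>"
  shows "parabolic_form t p (coeff (con0 X $ 1 $ 2) 0) (coeff (con0 X $ 1 $ 2) 1)
    = t * (t - 1) * ((\<Sum>i\<in>UNIV. \<kappa> $ i) - 1) / 2"
proof -
  define b0 where "b0 = coeff (con0 X $ 1 $ 2) 0"
  define b1 where "b1 = coeff (con0 X $ 1 $ 2) 1"
  have compat: "con_compatible t X" and
    res: "finite_residue t (\<kappa> $ 1) (p 1) (evm (con0 X) 0)"
    "finite_residue (1 - t) (\<kappa> $ 2) (p 2) (evm (con0 X) 1)"
    "finite_residue (t * (t - 1)) (\<kappa> $ 3) (p 3) (evm (con0 X) t)"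
    "infinite_residue (\<kappa> $ 4) (p 4) (evm (coninf X) 0)"
    using assms(5) unfolding pconns_bundleB_iff[OF t X] by auto
  note deg = con_compatible_bundleB_degree[OF X(1) compat]
  have b: "con0 X $ 1 $ 2 = [:b0, b1:]"
    unfolding b0_def b1_def by (rule poly_eq_linear[OF deg(3)])
  have "poly (coninf X $ 1 $ 2) 0 = - b1" "poly (coninf X $ 1 $ 1) 0 = - coeff (con0 X $ 1 $ 1) 2"
    using deg(2,4) by (simp_all add: b1_def)
  moreover have "poly (coninf X $ 1 $ 1) 0 = \<kappa> $ 4 / 2 - 1 / 2 - poly (coninf X $ 1 $ 2) 0 * p 4"
    using res(4) by (simp add: infinite_residue_def)
  ultimately have "coeff (con0 X $ 1 $ 1) 2 = - (\<kappa> $ 4 / 2 - 1 / 2 + b1 * p 4)"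
    by (simp add: equation_minus_iff)
  moreover have "poly (con0 X $ 1 $ 1) 0 = t * \<kappa> $ 1 / 2 - b0 * p 1"
    "poly (con0 X $ 1 $ 1) 1 = (1 - t) * \<kappa> $ 2 / 2 - (b0 + b1) * p 2"
    "poly (con0 X $ 1 $ 1) t = t * (t - 1) * \<kappa> $ 3 / 2 - (b0 + b1 * t) * p 3"
    using res(1-3) by (simp_all add: finite_residue_def b mult.commute)
  ultimately have "(t - 1) * (t * \<kappa> $ 1 / 2 - b0 * p 1) - t * ((1 - t) * \<kappa> $ 2 / 2 - (b0 + b1) * p 2)
      + (t * (t - 1) * \<kappa> $ 3 / 2 - (b0 + b1 * t) * p 3)
      - t * (t - 1) * - (\<kappa> $ 4 / 2 - 1 / 2 + b1 * p 4) = 0"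
    using quadratic_lead_coeff[OF deg(1), of t] by simp
  also have "(t - 1) * (t * \<kappa> $ 1 / 2 - b0 * p 1) - t * ((1 - t) * \<kappa> $ 2 / 2 - (b0 + b1) * p 2)
      + (t * (t - 1) * \<kappa> $ 3 / 2 - (b0 + b1 * t) * p 3)
      - t * (t - 1) * - (\<kappa> $ 4 / 2 - 1 / 2 + b1 * p 4)
      = t * (t - 1) * ((\<Sum>i\<in>UNIV. \<kappa> $ i) - 1) / 2 - parabolic_form t p b0 b1"
    unfolding parabolic_form_def sum_4 by (rule parabolic_form_identity)
  finally show ?thesis
    unfolding b0_def[symmetric] b1_def[symmetric] by simp
qed

section \<open>Uniqueness and existence of the connection with a given upper right entry\<close>

lemma coninf_determined:
  assumes "transition X = bundleB" "transition Y = bundleB"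
    and "con_compatible t X" "con_compatible t Y" "con0 X = con0 Y"
  shows "coninf X = coninf Y"
proof -
  note X = assms(3)[unfolded con_compatible_bundleB[OF assms(1)] assms(5), rule_format]
  note Y = assms(4)[unfolded con_compatible_bundleB[OF assms(2)], rule_format]
  have "evm (coninf X) w = evm (coninf Y) w" if "w \<noteq> 0" for w
    using X[of "1 / w"] Y[of "1 / w"] that by (auto simp: vec_eq_iff forall_2)
  then show ?thesis
    by (rule evm_eqI)
qed

text \<open>Once the upper right entry is known, the residues give the diagonal entries, of degree
  at most 2, at three points. The lower left entry may have degree 3, and the residue at infinity
  provides its leading coefficient as the fourth datum.\<close>

lemma connection_determined:
  assumes t: "t \<noteq> 0" "t \<noteq> 1"
    and X: "transition X = bundleB" "flag X = affine_flags p" "X \<in> pconns t \<kappa>"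
    and Y: "transition Y = bundleB" "flag Y = affine_flags p" "Y \<in> pconns t \<kappa>"
    and eq: "con0 X $ 1 $ 2 = con0 Y $ 1 $ 2"
  shows "X = Y"
proof -
  note rX = X(3)[unfolded pconns_bundleB_iff[OF t X(1,2)]]
  note rY = Y(3)[unfolded pconns_bundleB_iff[OF t Y(1,2)]]
  have compat: "con_compatible t X" "con_compatible t Y"
    using rX rY by auto
  note dX = con_compatible_bundleB_degree[OF X(1) compat(1)]
  note dY = con_compatible_bundleB_degree[OF Y(1) compat(2)]
  have card: "card {0, 1, t} = 3"
    using t by simp
  have beta: "poly (coninf X $ 1 $ 2) 0 = poly (coninf Y $ 1 $ 2) 0"
    using dX(4) dY(4) eq by simp
  have "con0 X $ 1 $ 1 = con0 Y $ 1 $ 1"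
    by (rule poly_eqI_degree[where A = "{0, 1, t}"])
      (use rX rY eq dX dY card in \<open>auto simp: finite_residue_def\<close>)
  moreover have "con0 X $ 2 $ 2 = con0 Y $ 2 $ 2"
    by (rule poly_eqI_degree[where A = "{0, 1, t}"])
      (use rX rY eq dX dY card in \<open>auto simp: finite_residue_def\<close>)
  moreover have "con0 X $ 2 $ 1 = con0 Y $ 2 $ 1"
    by (rule poly_eqI_degree_lead_coeff[where A = "{0, 1, t}" and n = 3])
      (use rX rY eq beta dX dY card in \<open>auto simp: finite_residue_def infinite_residue_def\<close>)
  ultimately have "con0 X = con0 Y"
    using eq by (simp add: vec_eq_iff forall_2)
  then show ?thesis
    using coninf_determined[OF X(1) Y(1) compat] X Y by (intro pconn.equality) auto
qed

lemma quadratic_interpolation: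
  fixes t :: complex
  assumes "t \<noteq> 0" "t \<noteq> 1"
  obtains e f where "a + e + f = b" "a + t * e + t ^ 2 * f = c"
    "t * (t - 1) * f = (t - 1) * a - t * b + c"
proof -
  define f where "f = ((t - 1) * a - t * b + c) / (t * (t - 1))"
  have f: "t * (t - 1) * f = (t - 1) * a - t * b + c"
    using assms by (simp add: f_def)
  have "a + t * (b - a - f) + t ^ 2 * f = c"
    using f by (simp add: algebra_simps power2_eq_square)
  with f show thesis
    by (intro that[of "b - a - f" f]) simp_all
qed

lemma connection_exists:
  assumes t: "t \<noteq> 0" "t \<noteq> 1"
    and form: "parabolic_form t p b0 b1 = t * (t - 1) * ((\<Sum>i\<in>UNIV. \<kappa> $ i) - 1) / 2"
  obtains X where "transition X = bundleB" "flag X = affine_flags p" "X \<in> pconns t \<kappa>"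
    "con0 X $ 1 $ 2 = [:b0, b1:]"
proof -
  obtain a1 a2 where a: "(t * \<kappa> $ 1 / 2 - b0 * p 1) + a1 + a2 = (1 - t) * \<kappa> $ 2 / 2 - (b0 + b1) * p 2"
    "(t * \<kappa> $ 1 / 2 - b0 * p 1) + t * a1 + t ^ 2 * a2 = t * (t - 1) * \<kappa> $ 3 / 2 - (b0 + b1 * t) * p 3"
    "t * (t - 1) * a2 = (t - 1) * (t * \<kappa> $ 1 / 2 - b0 * p 1)
      - t * ((1 - t) * \<kappa> $ 2 / 2 - (b0 + b1) * p 2) + (t * (t - 1) * \<kappa> $ 3 / 2 - (b0 + b1 * t) * p 3)"
    using quadratic_interpolation[OF t] by metis
  define a0 where "a0 = t * \<kappa> $ 1 / 2 - b0 * p 1"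
  define g0 where "g0 = (t * \<kappa> $ 1 - b0 * p 1) * p 1"
  define g3 where "g3 = - ((\<kappa> $ 4 + b1 * p 4) * p 4)"
  \<comment> \<open>The cubic term is already fixed by the residue at infinity, so its values at 1
    and \<open>t\<close> are subtracted and a quadratic remains to be interpolated.\<close>
  obtain g1 g2 where g: "g0 + g1 + g2 = ((1 - t) * \<kappa> $ 2 - (b0 + b1) * p 2) * p 2 - g3"
    "g0 + t * g1 + t ^ 2 * g2 = (t * (t - 1) * \<kappa> $ 3 - (b0 + b1 * t) * p 3) * p 3 - t ^ 3 * g3"
    using quadratic_interpolation[OF t] by metis
  \<comment> \<open>The one overdetermined place: the finite points already fix \<open>a2\<close>,
    and \<open>form\<close> says that it agrees with the value required at infinity.\<close>
  have "t * (t - 1) * a2 - t * (t - 1) * - (\<kappa> $ 4 / 2 - 1 / 2 + b1 * p 4) = 0"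
    unfolding a(3) parabolic_form_identity using form by (simp add: parabolic_form_def sum_4)
  then have a2: "a2 = - (\<kappa> $ 4 / 2 - 1 / 2 + b1 * p 4)"
    using t by (simp only: right_diff_distrib[symmetric] mult_eq_0_iff) simp
  \<comment> \<open>The finite residues have trace zero, hence the negated lower right entry. The
    overlap relation dictates \<open>coninf\<close>: reversed and negated coefficients, corrected by
    those of \<open>den0\<close> in the lower right corner.\<close>
  define X where "X = \<lparr>transition = bundleB,
    con0 = vector [vector [[:a0, a1, a2:], [:b0, b1:]], vector [[:g0, g1, g2, g3:], - [:a0, a1, a2:]]],
    coninf = vector [vector [[:- a2, - a1, - a0:], [:- b1, - b0:]],
      vector [[:- g3, - g2, - g1, - g0:], [:a2 - 1, a1 + 1 + t, a0 - t:]]],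
    flag = affine_flags p\<rparr>"
  have X: "transition X = bundleB" "flag X = affine_flags p" "con0 X $ 1 $ 2 = [:b0, b1:]"
    by (simp_all add: X_def)
  have "con_compatible t X"
    unfolding con_compatible_bundleB[OF X(1)]
    by (simp add: X_def field_simps power2_eq_square power3_eq_cube)
  moreover have "finite_residue t (\<kappa> $ 1) (p 1) (evm (con0 X) 0)"
    by (simp add: X_def finite_residue_def a0_def g0_def)
  moreover have "finite_residue (1 - t) (\<kappa> $ 2) (p 2) (evm (con0 X) 1)"
    using a(1) g(1) unfolding a0_def[symmetric]
    by (simp add: X_def finite_residue_def) (simp add: algebra_simps)
  moreover have "finite_residue (t * (t - 1)) (\<kappa> $ 3) (p 3) (evm (con0 X) t)"
  proof -
    have "a0 + t * (a1 + t * a2) = t * (t - 1) * \<kappa> $ 3 / 2 - (b0 + t * b1) * p 3"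
      using a(2) by (simp add: a0_def power2_eq_square algebra_simps)
    moreover have "g0 + t * (g1 + t * (g2 + t * g3)) = (t * (t - 1) * \<kappa> $ 3 - (b0 + t * b1) * p 3) * p 3"
      using g(2) by (simp add: power2_eq_square power3_eq_cube algebra_simps)
    moreover have "t * (- a1 - t * a2) - a0 = - (a0 + t * (a1 + t * a2))"
      by (simp add: algebra_simps)
    ultimately show ?thesis
      by (simp add: X_def finite_residue_def)
  qed
  moreover have "infinite_residue (\<kappa> $ 4) (p 4) (evm (coninf X) 0)"
    by (simp add: X_def infinite_residue_def a2 g3_def)
  ultimately show thesis
    using that X pconns_bundleB_iff[OF t X(1,2)] by blast
qed

section \<open>The subbundle O(1) and the apparent singularity\<close>

lemma line_subbundle_bundleB:
  assumes "line_subbundle bundleB 1 v0 vinf"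
  obtains c where "c \<noteq> 0" "v0 = vector [0, [:c:]]" "vinf = vector [0, [:c:]]"
proof -
  have *: "bundleB x *v evv vinf (1 / x) = x *s evv v0 x" if "x \<noteq> 0" for x
    using assms that by (simp add: line_subbundle_def)
  have 1: "poly (pCons 0 (v0 $ 1)) x = poly (vinf $ 1) (1 / x)"
    and 2: "poly (v0 $ 2) x = poly (vinf $ 2) (1 / x)" if "x \<noteq> 0" for x
    using *[OF that] that by (simp_all add: mat2_simps bundleB_def)
  \<comment> \<open>There is no nonzero map from O(1) to O: the constant \<open>d\<close> is
    divisible by x, hence zero.\<close>
  obtain d where "pCons 0 (v0 $ 1) = [:d:]" "vinf $ 1 = [:d:]"
    using poly_reciprocal_const[OF 1] .
  moreover obtain c where c: "v0 $ 2 = [:c:]" "vinf $ 2 = [:c:]"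
    using poly_reciprocal_const[OF 2] .
  ultimately have v: "v0 = vector [0, [:c:]]" "vinf = vector [0, [:c:]]"
    by (auto simp: vec_eq_iff forall_2)
  moreover have "evv v0 0 \<noteq> 0"
    using assms by (simp add: line_subbundle_def)
  then have "c \<noteq> 0"
    by (auto simp: v vec_eq_iff forall_2)
  ultimately show thesis
    using that by blast
qed

lemma line_subbundle_bundleB_exists: "line_subbundle bundleB 1 (vector [0, 1]) (vector [0, 1])"
  by (simp add: line_subbundle_def mat2_simps bundleB_def)

text \<open>A constant generator has no derivative term, so the second fundamental form of the
  summand O(1) is a constant multiple of the upper right entry.\<close>

lemma second_form_bundleB:
  "second_form q N (vector [0, [:c:]]) = - smult (c\<^sup>2) (N $ 1 $ 2)"
  by (simp add: second_form_def Let_def matrix_vector_nth2 power2_eq_square)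

text \<open>The zeros of a polynomial of degree at most 1 as a section of O(1), whose value at
  infinity is the coefficient of x.\<close>

fun linear_zero :: "complex poly \<Rightarrow> P1 \<Rightarrow> bool" where
  "linear_zero b (Aff x) \<longleftrightarrow> poly b x = 0"
| "linear_zero b Infty \<longleftrightarrow> coeff b 1 = 0"

lemma linear_zero_unique:
  assumes "degree b \<le> 1" "b \<noteq> 0"
  obtains z where "\<And>p. linear_zero b p \<longleftrightarrow> p = z"
proof -
  obtain b0 b1 where b: "b = [:b0, b1:]"
    using poly_eq_linear[OF assms(1)] by blast
  show thesis
  proof (cases "b1 = 0")
    case True
    then have "linear_zero b p \<longleftrightarrow> p = Infty" for p
      using assms(2) by (cases p) (auto simp: b)
    then show thesis
      by (rule that)
  next
    case False
    then have "linear_zero b p \<longleftrightarrow> p = Aff (- b0 / b1)" for p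
      by (cases p) (auto simp: b field_simps add_eq_0_iff)
    then show thesis
      by (rule that)
  qed
qed

text \<open>The fibre of O(1), spanned by (0, 1), is never one of the affine flags, so the copy is
  \<open>Plus\<close> even if the zero lies at a marked point.\<close>

lemma apparent_bundleB:
  assumes X: "transition X = bundleB" "flag X = affine_flags p" "con_compatible t X"
    and nz: "con0 X $ 1 $ 2 \<noteq> 0"
  obtains z where "\<And>q. linear_zero (con0 X $ 1 $ 2) q \<longleftrightarrow> q = z" "apparent t X = glue t Plus z"
proof -
  note deg = con_compatible_bundleB_degree[OF X(1,3)]
  obtain z where z: "\<And>q. linear_zero (con0 X $ 1 $ 2) q \<longleftrightarrow> q = z"
    using linear_zero_unique[OF deg(3) nz] by blast
  have zero: "second_form_zero t X (vector [0, [:c:]]) (vector [0, [:c:]]) q \<longleftrightarrow> q = z"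
    if "c \<noteq> 0" for c q
    using that deg(4) z[of q, symmetric] by (cases q) (auto simp: second_form_bundleB)
  have line: "line_at (vector [0, [:c:]]) (vector [0, [:c:]]) q \<noteq> affine_flags p $ i"
    if "c \<noteq> 0" for c q i
  proof
    assume eq: "line_at (vector [0, [:c:]]) (vector [0, [:c:]]) q = affine_flags p $ i"
    have "(vector [1, p i] :: complex ^ 2) \<in> affine_flags p $ i"
      by (simp add: affine_flags_def mem_cline_affine)
    then have "vector [1, p i] \<in> line_at (vector [0, [:c:]]) (vector [0, [:c:]]) q"
      by (simp add: eq)
    then show False
      by (cases q) (auto simp: cline_def vec_eq_iff forall_2)
  qed
  have "apparent_rel t X q \<longleftrightarrow> q = glue t Plus z" for q
  proof
    assume "apparent_rel t X q"
    then show "q = glue t Plus z"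
      unfolding apparent_rel_def X(1,2)
      by (auto elim!: line_subbundle_bundleB simp: zero line)
  next
    have "line_subbundle bundleB 1 (vector [0, [:1:]]) (vector [0, [:1:]])"
      using line_subbundle_bundleB_exists by (simp add: one_pCons)
    moreover assume "q = glue t Plus z"
    ultimately show "apparent_rel t X q"
      unfolding apparent_rel_def X(1,2)
      by (intro exI[of _ "vector [0, [:1:]]"] exI[of _ z]) (simp add: zero line)
  qed
  then have "apparent t X = glue t Plus z"
    by (simp add: apparent_eq)
  with z show thesis
    by (rule that)
qed

section \<open>Automorphisms and simple quasiparabolic structures\<close>

text \<open>Entry by entry, an endomorphism consists of constants on the diagonal, a section of O(1)
  below it, and above it a map from O(1) to O, which is zero.\<close>

lemma bundle_hom_bundleB:
  assumes "bundle_hom bundleB bundleB h0 hinf"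
  obtains a d b0 b1 where "h0 = vector [vector [[:a:], 0], vector [[:b0, b1:], [:d:]]]"
    "hinf = vector [vector [[:a:], 0], vector [[:b1, b0:], [:d:]]]"
proof -
  have *: "poly (h0 $ 1 $ 1) x = poly (hinf $ 1 $ 1) (1 / x)"
    "poly (pCons 0 (h0 $ 1 $ 2)) x = poly (hinf $ 1 $ 2) (1 / x)"
    "poly (h0 $ 2 $ 1) x = x ^ 1 * poly (hinf $ 2 $ 1) (1 / x)"
    "poly (h0 $ 2 $ 2) x = poly (hinf $ 2 $ 2) (1 / x)" if "x \<noteq> 0" for x
    using assms that unfolding bundle_hom_def
    by (simp_all add: mat2_simps bundleB_def mult.commute)
  obtain a where a: "h0 $ 1 $ 1 = [:a:]" "hinf $ 1 $ 1 = [:a:]"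
    using poly_reciprocal_const[OF *(1)] .
  obtain c where c: "pCons 0 (h0 $ 1 $ 2) = [:c:]" "hinf $ 1 $ 2 = [:c:]"
    using poly_reciprocal_const[OF *(2)] .
  obtain d where d: "h0 $ 2 $ 2 = [:d:]" "hinf $ 2 $ 2 = [:d:]"
    using poly_reciprocal_const[OF *(4)] .
  obtain b0 b1 where b: "h0 $ 2 $ 1 = [:b0, b1:]"
    using poly_eq_linear[OF poly_reciprocal_degree(1)[OF *(3)]] by blast
  have "hinf $ 2 $ 1 = [:b1, b0:]"
  proof (rule poly_eqI_punctured)
    fix w :: complex assume "w \<noteq> 0"
    then show "poly (hinf $ 2 $ 1) w = poly [:b1, b0:] w"
      using *(3)[of "1 / w"] by (simp add: b field_simps)
  qed
  with a b c d show thesis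
    by (intro that[of a b0 b1 d]) (auto simp: vec_eq_iff forall_2)
qed

text \<open>The values at the marked points of the section \<open>b0 + b1 x\<close> of \<open>O(1)\<close>.\<close>

definition section_value :: "complex \<Rightarrow> complex \<Rightarrow> complex \<Rightarrow> 4 \<Rightarrow> complex" where
  "section_value t b0 b1 i =
     (if i = 1 then b0 else if i = 2 then b0 + b1 else if i = 3 then b0 + b1 * t else b1)"

lemma fibre_map_bundleB:
  "fibre_map (vector [vector [[:a:], 0], vector [[:b0, b1:], [:d:]]])
     (vector [vector [[:a:], 0], vector [[:b1, b0:], [:d:]]]) (marked t i) *v vector [1, z]
   = vector [a, section_value t b0 b1 i + d * z]"
  using exhaust_4[of i] by (auto simp: marked_def section_value_def mat2_simps)

text \<open>The form vanishes on section values: by interpolation the sum over the finite points is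
  the leading coefficient of a product of two linear polynomials, and the term at infinity subtracts
  exactly that.\<close>

lemma parabolic_form_affine:
  "parabolic_form t (\<lambda>i. r * section_value t b0 b1 i + s * p i) c0 c1 = s * parabolic_form t p c0 c1"
  by (simp add: parabolic_form_def section_value_def algebra_simps)

lemma parabolic_form_scale: "parabolic_form t p (c * b0) (c * b1) = c * parabolic_form t p b0 b1"
  by (simp add: parabolic_form_def algebra_simps)

lemma cline_affine: "v $ 1 \<noteq> 0 \<Longrightarrow> cline v = cline (vector [1, v $ 2 / v $ 1])"
proof -
  assume v: "v $ 1 \<noteq> 0"
  then have "w \<in> cline v \<longleftrightarrow> w \<in> cline (vector [1, v $ 2 / v $ 1])" for w
    unfolding mem_cline_affine cline_def
    by (auto simp: vec_eq_iff forall_2 image_iff intro!: exI[of _ "w $ 1 / v $ 1"])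
  then show ?thesis
    by blast
qed

section \<open>Generic pairs of flags and points, and their invariance\<close>

definition generic_pairs :: "complex \<Rightarrow> (parstr \<times> P1) set" where
  "generic_pairs t =
     {(affine_flags p, Aff y) | p y. y \<notin> {0, 1, t} \<and> parabolic_form t p (- y) 1 \<noteq> 0}"

text \<open>An endomorphism preserving the flags yields a section of O(1) with values
  \<open>(a - d) * p i\<close>. The form kills it, so \<open>a = d\<close>; then the section
  vanishes at 0 and at infinity, which removes both of its coefficients.\<close>

lemma affine_flags_simple:
  assumes "parabolic_form t p c0 c1 \<noteq> 0"
  shows "affine_flags p \<in> Qsimple t"
proof -
  have "\<exists>c. h0 = mat [:c:] \<and> hinf = mat [:c:]"
    if hom: "bundle_hom bundleB bundleB h0 hinf"
      and flags: "\<And>i. (\<lambda>v. fibre_map h0 hinf (marked t i) *v v) ` (affine_flags p $ i) \<subseteq> affine_flags p $ i"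
    for h0 hinf
  proof -
    obtain a d b0 b1 where h: "h0 = vector [vector [[:a:], 0], vector [[:b0, b1:], [:d:]]]"
      "hinf = vector [vector [[:a:], 0], vector [[:b1, b0:], [:d:]]]"
      using bundle_hom_bundleB[OF hom] .
    have "vector [1, p i] \<in> affine_flags p $ i" for i
      by (simp add: affine_flags_def mem_cline_affine)
    then have "fibre_map h0 hinf (marked t i) *v vector [1, p i] \<in> affine_flags p $ i" for i
      using flags[of i] by blast
    then have sec: "section_value t b0 b1 i = (a - d) * p i" for i
      unfolding h fibre_map_bundleB
      by (simp add: affine_flags_def mem_cline_affine algebra_simps eq_diff_eq)
    have "0 = parabolic_form t (\<lambda>i. - 1 * section_value t b0 b1 i + (a - d) * p i) c0 c1"
      by (simp add: sec parabolic_form_def)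
    then have "a = d"
      using assms unfolding parabolic_form_affine by simp
    moreover have "b0 = 0" "b1 = 0"
      using sec[of 1] sec[of 4] \<open>a = d\<close> by (simp_all add: section_value_def)
    ultimately show ?thesis
      unfolding h by (intro exI[of _ d]) (simp add: mat2_simps)
  qed
  then show ?thesis
    unfolding Qsimple_def qp_simple_def using is_parstr_affine_flags by blast
qed

lemma generic_pairs_simple: "(P, q) \<in> generic_pairs t \<Longrightarrow> P \<in> Qsimple t"
  by (auto simp: generic_pairs_def intro: affine_flags_simple)

text \<open>An automorphism adds section values to the flag coordinates and rescales them by
  \<open>d / a\<close>, so the form is only multiplied by this nonzero factor.\<close>

lemma generic_pairs_invariant:
  assumes "(P, q) \<in> generic_pairs t" "(P, P') \<in> AutB_rel t"
  shows "(P', q) \<in> generic_pairs t"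
proof -
  obtain p y where P: "P = affine_flags p" "q = Aff y" "y \<notin> {0, 1, t}"
    "parabolic_form t p (- y) 1 \<noteq> 0"
    using assms(1) by (auto simp: generic_pairs_def)
  obtain h0 hinf where iso: "bundle_iso bundleB bundleB h0 hinf"
    and img: "\<And>i. (\<lambda>v. fibre_map h0 hinf (marked t i) *v v) ` (P $ i) = P' $ i"
    using assms(2) unfolding AutB_rel_def qp_isomorphic_def by blast
  obtain a d b0 b1 where h: "h0 = vector [vector [[:a:], 0], vector [[:b0, b1:], [:d:]]]"
    "hinf = vector [vector [[:a:], 0], vector [[:b1, b0:], [:d:]]]"
    using bundle_hom_bundleB iso unfolding bundle_iso_def by metis
  have "det (fibre_map h0 hinf (Aff 0)) \<noteq> 0"
    using iso unfolding bundle_iso_def by blast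
  then have ad: "a \<noteq> 0" "d \<noteq> 0"
    by (auto simp: h det_2)
  have "P' $ i = cline (vector [1, 1 / a * section_value t b0 b1 i + d / a * p i])" for i
  proof -
    have "P' $ i = cline (vector [a, section_value t b0 b1 i + d * p i])"
      unfolding img[symmetric] P affine_flags_def h by (simp add: cline_image fibre_map_bundleB)
    also have "\<dots> = cline (vector [1, 1 / a * section_value t b0 b1 i + d / a * p i])"
      using ad by (subst cline_affine) (simp_all add: add_divide_distrib)
    finally show ?thesis .
  qed
  then have "P' = affine_flags (\<lambda>i. 1 / a * section_value t b0 b1 i + d / a * p i)"
    by (simp add: affine_flags_def vec_eq_iff)
  moreover have "parabolic_form t (\<lambda>i. 1 / a * section_value t b0 b1 i + d / a * p i) (- y) 1 \<noteq> 0"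
    unfolding parabolic_form_affine using P(4) ad by simp
  ultimately show ?thesis
    using P(2,3) unfolding generic_pairs_def by blast
qed

section \<open>Zariski openness and density of the generic pairs\<close>

lemma polyfun_diff: "polyfun f \<Longrightarrow> polyfun g \<Longrightarrow> polyfun (\<lambda>u y. f u y - g u y)"
  using polyfun.intros(4)[OF _ polyfun.intros(5)[OF polyfun.intros(1)[of "- 1"]], of f g] by simp

text \<open>The homogenisation of the parabolic form at \<open>(- y, 1)\<close>, multiplied by the coordinates that have
  to be nonzero.\<close>

definition generic_equation :: "complex \<Rightarrow> (complex ^ 2) ^ 4 \<Rightarrow> complex ^ 2 \<Rightarrow> complex" where
  "generic_equation t u y =
     u $ 1 $ 1 * u $ 2 $ 1 * u $ 3 $ 1 * u $ 4 $ 1 * y $ 2 * y $ 1 * (y $ 1 - y $ 2) *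
     (y $ 1 - t * y $ 2) *
     (t * (y $ 1 - y $ 2) * u $ 1 $ 1 * u $ 2 $ 2 * u $ 3 $ 1 * u $ 4 $ 1
       - (t - 1) * y $ 1 * u $ 1 $ 2 * u $ 2 $ 1 * u $ 3 $ 1 * u $ 4 $ 1
       - (y $ 1 - t * y $ 2) * u $ 1 $ 1 * u $ 2 $ 1 * u $ 3 $ 2 * u $ 4 $ 1
       - t * (t - 1) * y $ 2 * u $ 1 $ 1 * u $ 2 $ 1 * u $ 3 $ 1 * u $ 4 $ 2)"

lemma polyfun_generic_equation: "polyfun (generic_equation t)"
  unfolding generic_equation_def by (intro polyfun.intros polyfun_diff)

text \<open>The product of the first flag coordinates occurs once as a prefactor and once through
  the homogenised form. The fifth power of \<open>y $ 2\<close> collects one prefactor, the three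
  linear factors and one power from the form.\<close>

lemma generic_equation_affine:
  assumes "\<And>i. u $ i $ 2 = p i * u $ i $ 1" "y $ 1 = z * y $ 2"
  shows "generic_equation t u y = (u $ 1 $ 1 * u $ 2 $ 1 * u $ 3 $ 1 * u $ 4 $ 1)\<^sup>2 * (y $ 2) ^ 5 *
     (z * (z - 1) * (z - t) * parabolic_form t p (- z) 1)"
proof -
  have "t * (y $ 1 - y $ 2) * u $ 1 $ 1 * u $ 2 $ 2 * u $ 3 $ 1 * u $ 4 $ 1
       - (t - 1) * y $ 1 * u $ 1 $ 2 * u $ 2 $ 1 * u $ 3 $ 1 * u $ 4 $ 1
       - (y $ 1 - t * y $ 2) * u $ 1 $ 1 * u $ 2 $ 1 * u $ 3 $ 2 * u $ 4 $ 1
       - t * (t - 1) * y $ 2 * u $ 1 $ 1 * u $ 2 $ 1 * u $ 3 $ 1 * u $ 4 $ 2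
    = u $ 1 $ 1 * u $ 2 $ 1 * u $ 3 $ 1 * u $ 4 $ 1 * y $ 2 * parabolic_form t p (- z) 1"
    unfolding parabolic_form_def assms by (simp add: algebra_simps)
  moreover have "y $ 1 * (y $ 1 - y $ 2) * (y $ 1 - t * y $ 2) = (y $ 2) ^ 3 * (z * (z - 1) * (z - t))"
    unfolding assms by (simp add: algebra_simps power3_eq_cube)
  moreover have "U * Y * y1 * y2 * y3 * L = U\<^sup>2 * Y ^ 5 * (Z * F)"
    if "L = U * Y * F" "y1 * y2 * y3 = Y ^ 3 * Z" for U Y y1 y2 y3 L Z F :: complex
  proof -
    have "U * Y * y1 * y2 * y3 * L = U * Y * (y1 * y2 * y3) * L"
      by simp
    also have "\<dots> = U\<^sup>2 * Y ^ 5 * (Z * F)"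
      unfolding that by (simp add: power2_eq_square eval_nat_numeral)
    finally show ?thesis .
  qed
  ultimately show ?thesis
    unfolding generic_equation_def by blast
qed

lemma generic_equation_nonzero:
  assumes "generic_equation t u y \<noteq> 0"
  shows "u $ i $ 1 \<noteq> 0" "u $ i \<noteq> 0" "y $ 2 \<noteq> 0" "y \<noteq> 0"
proof -
  show "u $ i $ 1 \<noteq> 0"
    using assms exhaust_4[of i] by (auto simp: generic_equation_def)
  then show "u $ i \<noteq> 0"
    by auto
  show "y $ 2 \<noteq> 0"
    using assms by (auto simp: generic_equation_def)
  then show "y \<noteq> 0"
    by auto
qed

lemma generic_pairs_iff:
  assumes "\<And>i. u $ i \<noteq> 0"
  shows "((\<chi> i. cline (u $ i)), hom_point y) \<in> generic_pairs t \<longleftrightarrow> generic_equation t u y \<noteq> 0"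
proof
  assume "((\<chi> i. cline (u $ i)), hom_point y) \<in> generic_pairs t"
  then obtain p z where p: "(\<chi> i. cline (u $ i)) = affine_flags p" "hom_point y = Aff z"
    "z \<notin> {0, 1, t}" "parabolic_form t p (- z) 1 \<noteq> 0"
    by (auto simp: generic_pairs_def)
  have u: "u $ i $ 2 = p i * u $ i $ 1" for i
  proof -
    have "u $ i \<in> cline (u $ i)"
      unfolding cline_def by (rule range_eqI[of _ _ 1]) simp
    then show ?thesis
      using p(1) by (simp add: affine_flags_def vec_eq_iff mem_cline_affine[symmetric])
  qed
  moreover have "u $ i $ 1 \<noteq> 0" for i
    using assms[of i] u[of i] by (auto simp: vec_eq_iff forall_2)
  moreover have y: "y $ 2 \<noteq> 0" "y $ 1 = z * y $ 2"
    using p(2) by (auto simp: hom_point_def split: if_splits)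
  ultimately show "generic_equation t u y \<noteq> 0"
    using p by (simp add: generic_equation_affine[OF u y(2)])
next
  assume nz: "generic_equation t u y \<noteq> 0"
  note nonzero = generic_equation_nonzero[OF nz]
  define p where "p = (\<lambda>i. u $ i $ 2 / u $ i $ 1)"
  define z where "z = y $ 1 / y $ 2"
  have "(\<chi> i. cline (u $ i)) = affine_flags p"
    using nonzero(1) by (simp add: affine_flags_def p_def vec_eq_iff cline_affine[symmetric])
  moreover have "hom_point y = Aff z"
    using nonzero(3) by (simp add: hom_point_def z_def)
  moreover have "z * (z - 1) * (z - t) * parabolic_form t p (- z) 1 \<noteq> 0"
    using nz generic_equation_affine[of u p y z t] nonzero(1,3) by (auto simp: p_def z_def)
  ultimately show "((\<chi> i. cline (u $ i)), hom_point y) \<in> generic_pairs t"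
    unfolding generic_pairs_def by auto
qed

lemma zariski_open_generic_pairs: "zariski_open (generic_pairs t)"
  unfolding zariski_open_def
proof (intro conjI exI[of _ "{generic_equation t}"])
  show "generic_pairs t \<subseteq> Collect is_parstr \<times> UNIV"
    by (auto simp: generic_pairs_def is_parstr_affine_flags)
qed (simp_all add: polyfun_generic_equation generic_pairs_iff)

lemma polyfun_on_line:
  assumes "polyfun f"
  shows "\<exists>q. \<forall>s. f (\<chi> i j. u $ i $ j + s * (u' $ i $ j - u $ i $ j)) (\<chi> j. y $ j + s * (y' $ j - y $ j)) = poly q s"
  using assms
proof induction
  case (1 c)
  show ?case
    by (rule exI[of _ "[:c:]"]) simp
next
  case (2 i j)
  show ?case
    by (rule exI[of _ "[:u $ i $ j, u' $ i $ j - u $ i $ j:]"]) simp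
next
  case (3 j)
  show ?case
    by (rule exI[of _ "[:y $ j, y' $ j - y $ j:]"]) simp
next
  case (4 f g)
  then show ?case
    by (metis poly_add)
next
  case (5 f g)
  then show ?case
    by (metis poly_mult)
qed

text \<open>Irreducibility of affine space: on the line joining the two given points both functions
  become nonzero polynomials in one variable, and so does their product.\<close>

lemma polyfun_common_nonzero:
  assumes "polyfun f" "polyfun g" "f u y \<noteq> 0" "g u' y' \<noteq> 0"
  obtains v z where "f v z \<noteq> 0" "g v z \<noteq> 0"
proof -
  define v where "v s = (\<chi> i j. u $ i $ j + s * (u' $ i $ j - u $ i $ j))" for s
  define z where "z s = (\<chi> j. y $ j + s * (y' $ j - y $ j))" for s
  obtain p q where p: "\<And>s. f (v s) (z s) = poly p s" and q: "\<And>s. g (v s) (z s) = poly q s"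
    using polyfun_on_line[OF assms(1), of u u' y y'] polyfun_on_line[OF assms(2), of u u' y y']
    unfolding v_def z_def by blast
  have "v 0 = u" "z 0 = y" "v 1 = u'" "z 1 = y'"
    by (simp_all add: v_def z_def vec_eq_iff)
  then have "p * q \<noteq> 0"
    using p[of 0] q[of 1] assms(3,4) by auto
  then obtain s where "poly (p * q) s \<noteq> 0"
    by (metis poly_all_0_iff_0)
  then show thesis
    using that[of "v s" "z s"] by (simp add: p q)
qed

text \<open>Both sets are tested on homogeneous coordinates. A point of the joining line could leave
  the punctured planes, but nonvanishing of \<open>generic_equation\<close> already excludes zero
  coordinate vectors.\<close>

lemma zariski_open_meets_generic_pairs:
  assumes V: "zariski_open V" "V \<noteq> {}" and "generic_pairs t \<noteq> {}"
  shows "V \<inter> generic_pairs t \<noteq> {}"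
proof -
  have coords: "\<exists>u y. (\<forall>i. u $ i \<noteq> 0) \<and> y \<noteq> 0 \<and> P = (\<chi> i. cline (u $ i)) \<and> q = hom_point y"
    if P: "is_parstr P" for P q
  proof -
    have "\<exists>v. v \<noteq> 0 \<and> P $ i = cline v" for i
      using P by (simp add: is_parstr_def is_line_def)
    then obtain v where "\<And>i. v i \<noteq> 0 \<and> P $ i = cline (v i)"
      by metis
    then have "(\<forall>i. (\<chi> i. v i) $ i \<noteq> 0) \<and> P = (\<chi> i. cline ((\<chi> i. v i) $ i))"
      by (simp add: vec_eq_iff)
    moreover have "\<exists>y. y \<noteq> 0 \<and> q = hom_point y"
    proof (cases q)
      case (Aff x)
      then show ?thesis
        by (intro exI[of _ "vector [x, 1]"]) (simp add: hom_point_def vec_eq_iff forall_2)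
    next
      case Infty
      then show ?thesis
        by (intro exI[of _ "vector [1, 0]"]) (simp add: hom_point_def vec_eq_iff forall_2)
    qed
    ultimately show ?thesis
      by blast
  qed
  obtain F where F: "\<And>f. f \<in> F \<Longrightarrow> polyfun f"
    "\<And>u y. (\<forall>i. u $ i \<noteq> 0) \<and> y \<noteq> 0 \<Longrightarrow>
      ((\<chi> i. cline (u $ i)), hom_point y) \<in> V \<longleftrightarrow> (\<exists>f \<in> F. f u y \<noteq> 0)"
    and sub: "V \<subseteq> Collect is_parstr \<times> UNIV"
    using V(1) unfolding zariski_open_def by blast
  obtain P q where Pq: "(P, q) \<in> V" "is_parstr P"
    using V(2) sub by auto
  obtain u y where uy: "(\<forall>i. u $ i \<noteq> 0) \<and> y \<noteq> 0" "P = (\<chi> i. cline (u $ i))" "q = hom_point y"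
    using coords[OF Pq(2)] by metis
  obtain f where f: "f \<in> F" "f u y \<noteq> 0"
    using F(2)[OF uy(1)] Pq(1) uy(2,3) by auto
  obtain P' q' where Pq': "(P', q') \<in> generic_pairs t" "is_parstr P'"
    using assms(3) zariski_open_generic_pairs[of t] unfolding zariski_open_def by auto
  obtain u' y' where uy': "\<forall>i. u' $ i \<noteq> 0" "P' = (\<chi> i. cline (u' $ i))" "q' = hom_point y'"
    using coords[OF Pq'(2)] by metis
  have "generic_equation t u' y' \<noteq> 0"
    using generic_pairs_iff[of u' y' t] Pq'(1) uy' by auto
  then obtain v z where vz: "f v z \<noteq> 0" "generic_equation t v z \<noteq> 0"
    using polyfun_common_nonzero[OF F(1)[OF f(1)] polyfun_generic_equation f(2)] by metis
  note nonzero = generic_equation_nonzero[OF vz(2)]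
  have "((\<chi> i. cline (v $ i)), hom_point z) \<in> V"
    using F(2)[of v z] nonzero f(1) vz(1) by blast
  moreover have "((\<chi> i. cline (v $ i)), hom_point z) \<in> generic_pairs t"
    using generic_pairs_iff nonzero(2) vz(2) by blast
  ultimately show ?thesis
    by blast
qed

lemma generic_pairs_nonempty:
  assumes "t \<noteq> 0" "t \<noteq> 1"
  shows "generic_pairs t \<noteq> {}"
proof -
  obtain y where "y \<notin> {0, 1, t}"
    using ex_new_if_finite[OF infinite_UNIV_char_0, of "{0, 1, t}"] by auto
  \<comment> \<open>Only the term at infinity survives for this flag, with value
    \<open>- (t * (t - 1))\<close>.\<close>
  moreover have "parabolic_form t (\<lambda>i. if i = 4 then 1 else 0) (- y) 1 \<noteq> 0"
    using assms by (simp add: parabolic_form_def)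
  ultimately show ?thesis
    by (auto simp: generic_pairs_def)
qed

section \<open>Strong transversality\<close>

lemma open_curve_Aff: "Aff y \<in> open_curve t \<longleftrightarrow> y \<notin> {0, 1, t}"
proof -
  have "Aff y \<in> open_curve t \<longleftrightarrow> (\<forall>i. marked t i \<noteq> Aff y)"
    unfolding open_curve_def by (metis ComplI ComplD rangeE rangeI)
  then show ?thesis
    unfolding forall_4 marked_simps by auto
qed

lemma generic_pairs_open_curve: "(P, q) \<in> generic_pairs t \<Longrightarrow> q \<in> open_curve t"
  by (auto simp: generic_pairs_def open_curve_Aff)

lemma glue_open_curve: "q \<in> open_curve t \<Longrightarrow> glue t s q = glue t s' q"
  by (simp add: glue_def)

lemma glue_eqD: "glue t s q = glue t s' q' \<Longrightarrow> q = q'"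
proof -
  have "snd ` glue t s q = {q}" for s q
    by (simp add: glue_def)
  then show "glue t s q = glue t s' q' \<Longrightarrow> q = q'"
    by (metis singleton_inject)
qed

definition generic_locus :: "complex \<Rightarrow> (parstr set \<times> (copy \<times> P1) set) set" where
  "generic_locus t = {(AutB_rel t `` {P}, glue t Plus q) | P q. (P, q) \<in> generic_pairs t}"

text \<open>Invariance under automorphisms makes the condition independent of the representative of
  the orbit. As the second component lies in U, where the copies are identified, either copy
  \<open>s\<close> gives the same preimage.\<close>

lemma generic_locus_preimage:
  "{(P, q). P \<in> Qsimple t \<and> (AutB_rel t `` {P}, glue t s q) \<in> generic_locus t} = generic_pairs t"
proof (intro set_eqI iffI; clarify)
  fix P q assume P: "P \<in> Qsimple t" and "(AutB_rel t `` {P}, glue t s q) \<in> generic_locus t"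
  then obtain P1 q1 where eq: "AutB_rel t `` {P} = AutB_rel t `` {P1}" "glue t s q = glue t Plus q1"
    and gen: "(P1, q1) \<in> generic_pairs t"
    by (auto simp: generic_locus_def)
  have "(P1, P) \<in> AutB_rel t"
    using eq_equiv_class[OF eq(1)[symmetric] equiv_AutB_rel P] .
  then show "(P, q) \<in> generic_pairs t"
    using generic_pairs_invariant[OF gen] glue_eqD[OF eq(2)] by blast
next
  fix P q assume gen: "(P, q) \<in> generic_pairs t"
  then have "glue t s q = glue t Plus q"
    by (intro glue_open_curve generic_pairs_open_curve)
  then show "P \<in> Qsimple t \<and> (AutB_rel t `` {P}, glue t s q) \<in> generic_locus t"
    using gen generic_pairs_simple[OF gen] unfolding generic_locus_def by blast
qed

lemma base_open_generic_locus: "base_open t (generic_locus t)"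
  unfolding base_open_def generic_locus_preimage
proof (intro conjI allI zariski_open_generic_pairs)
  show "generic_locus t \<subseteq> Qorbits t \<times> glued_curve t"
    by (auto simp: generic_locus_def Qorbits_def glued_curve_def intro!: quotientI generic_pairs_simple)
qed

lemma base_dense_generic_locus:
  assumes "t \<noteq> 0" "t \<noteq> 1"
  shows "base_dense t (generic_locus t)"
  unfolding base_dense_def
proof (intro allI impI; elim conjE)
  fix V assume V: "base_open t V" "V \<noteq> {}"
  then obtain c r where cr: "(c, r) \<in> V" "c \<in> Qorbits t" "r \<in> glued_curve t"
    unfolding base_open_def by auto
  obtain P where P: "P \<in> Qsimple t" "c = AutB_rel t `` {P}"
    using cr(2) unfolding Qorbits_def by (rule quotientE)
  obtain s q where "r = glue t s q"
    using cr(3) unfolding glued_curve_def by blast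
  with cr P have Pq: "P \<in> Qsimple t" "(AutB_rel t `` {P}, glue t s q) \<in> V"
    by simp_all
  define S where "S = {(P, q). P \<in> Qsimple t \<and> (AutB_rel t `` {P}, glue t s q) \<in> V}"
  have "zariski_open S" "S \<noteq> {}"
    using V(1) Pq unfolding base_open_def S_def by blast+
  then have "S \<inter> generic_pairs t \<noteq> {}"
    using zariski_open_meets_generic_pairs generic_pairs_nonempty[OF assms] by blast
  then obtain P' q' where "(P', q') \<in> S" "(P', q') \<in> generic_pairs t"
    by auto
  then have "(AutB_rel t `` {P'}, glue t s q') \<in> V \<inter> generic_locus t"
    unfolding generic_locus_preimage[of t s, symmetric] S_def by blast
  then show "V \<inter> generic_locus t \<noteq> {}"
    by blast
qed

section \<open>Values of the two maps on isomorphism classes\<close>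

lemma moduli_eq: "moduli t \<kappa> = pconns t \<kappa> // pconn_rel t \<kappa>"
  by (simp add: moduli_def pconn_rel_def)

lemma the_elem_class:
  assumes "X \<in> pconns t \<kappa>" "\<And>Y. (X, Y) \<in> pconn_rel t \<kappa> \<Longrightarrow> f Y = f X"
  shows "the_elem (f ` (pconn_rel t \<kappa> `` {X})) = f X"
proof -
  have "f ` (pconn_rel t \<kappa> `` {X}) = (\<lambda>_. f X) ` (pconn_rel t \<kappa> `` {X})"
    by (rule image_cong[OF refl], rule assms(2)) simp
  also have "\<dots> = {f X}"
    using equiv_class_self[OF equiv_pconn_rel assms(1)] by (rule image_constant)
  finally show ?thesis
    by simp
qed

lemma Phi_class:
  assumes "X \<in> pconns t \<kappa>"
  shows "Phi t (pconn_rel t \<kappa> `` {X}) = par_class t X"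
  unfolding Phi_def
  by (rule the_elem_class[OF assms], rule par_class_iso[symmetric]) (auto simp: pconn_rel_def intro: pconns_is_bundle)

lemma Upsilon_class:
  assumes "X \<in> pconns t \<kappa>"
  shows "Upsilon t (pconn_rel t \<kappa> `` {X}) = apparent t X"
  unfolding Upsilon_def
  by (rule the_elem_class[OF assms], rule apparent_iso[symmetric]) (auto simp: pconn_rel_def intro: pconns_is_bundle)

lemma par_class_bundleB:
  assumes "transition X = bundleB" "flag X \<in> Qsimple t"
  shows "par_class t X = AutB_rel t `` {flag X}"
proof -
  have "qp_isomorphic t bundleB P bundleB (flag X) \<longleftrightarrow> qp_isomorphic t bundleB (flag X) bundleB P" for P
    using qp_isomorphic_sym[OF _ is_bundle_bundleB is_bundle_bundleB] by blast
  then show ?thesis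
    using assms by (simp add: par_class_def AutB_rel_def Image_def)
qed

lemma apparent_bundleB_iff:
  fixes \<kappa> :: "complex ^ 4"
  defines "c \<equiv> \<lambda>t. t * (t - 1) * ((\<Sum>i\<in>UNIV. \<kappa> $ i) - 1) / 2"
  assumes t: "t \<noteq> 0" "t \<noteq> 1" and \<kappa>: "(\<Sum>i\<in>UNIV. \<kappa> $ i) \<noteq> 1"
    and form: "parabolic_form t p (- y) 1 \<noteq> 0" and y: "y \<notin> {0, 1, t}"
    and X: "transition X = bundleB" "flag X = affine_flags p" "X \<in> pconns t \<kappa>"
  shows "apparent t X = glue t Plus (Aff y) \<longleftrightarrow>
    con0 X $ 1 $ 2 = smult (c t / parabolic_form t p (- y) 1) [:- y, 1:]"
proof -
  define b0 where "b0 = coeff (con0 X $ 1 $ 2) 0"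
  define b1 where "b1 = coeff (con0 X $ 1 $ 2) 1"
  have compat: "con_compatible t X"
    using X(3) by (simp add: pconns_def)
  have b: "con0 X $ 1 $ 2 = [:b0, b1:]"
    unfolding b0_def b1_def
    by (rule poly_eq_linear[OF con_compatible_bundleB_degree(3)[OF X(1) compat]])
  have c: "parabolic_form t p b0 b1 = c t"
    unfolding b0_def b1_def c_def by (rule parabolic_form_con0[OF t X])
  have "c t \<noteq> 0"
    using t \<kappa> by (simp add: c_def)
  \<comment> \<open>The form is zero on the zero polynomial, whereas the right hand side is not;
    hence there is exactly one apparent singularity.\<close>
  then have nz: "con0 X $ 1 $ 2 \<noteq> 0"
    using c by (auto simp: b parabolic_form_def)
  obtain z where z: "\<And>q. linear_zero (con0 X $ 1 $ 2) q \<longleftrightarrow> q = z" "apparent t X = glue t Plus z"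
    using apparent_bundleB[OF X(1,2) compat nz] by blast
  have "apparent t X = glue t Plus (Aff y) \<longleftrightarrow> z = Aff y"
    unfolding z(2) by (blast dest: glue_eqD)
  also have "\<dots> \<longleftrightarrow> poly (con0 X $ 1 $ 2) y = 0"
    using z(1)[of "Aff y"] by auto
  also have "\<dots> \<longleftrightarrow> con0 X $ 1 $ 2 = smult (c t / parabolic_form t p (- y) 1) [:- y, 1:]"
  proof
    assume "poly (con0 X $ 1 $ 2) y = 0"
    then have "b0 = b1 * - y"
      by (simp add: b add_eq_0_iff mult.commute)
    then have "b1 * parabolic_form t p (- y) 1 = c t"
      using c parabolic_form_scale[of t p b1 "- y" 1] by simp
    then have "b1 = c t / parabolic_form t p (- y) 1"
      using form by (simp add: field_simps)
    with \<open>b0 = b1 * - y\<close> show "con0 X $ 1 $ 2 = smult (c t / parabolic_form t p (- y) 1) [:- y, 1:]"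
      by (simp add: b)
  qed simp
  finally show ?thesis .
qed

theorem theorem8p1:
  fixes t :: complex and \<kappa> :: "complex ^ 4"
  assumes "t \<noteq> 0" and "t \<noteq> 1"
    and "kostov_generic \<kappa>"
  shows "\<exists>W. W \<noteq> {} \<and> base_open t W \<and> base_dense t W \<and>
    (\<forall>(p, q) \<in> W. \<exists>!m. m \<in> moduli t \<kappa> \<and> Phi t m = p \<and> Upsilon t m = q)"
proof (intro exI[of _ "generic_locus t"] conjI base_open_generic_locus
    base_dense_generic_locus assms(1,2))
  show "generic_locus t \<noteq> {}"
  proof -
    obtain P q where "(P, q) \<in> generic_pairs t"
      using generic_pairs_nonempty[OF assms(1,2)] by (metis ex_in_conv surj_pair)
    then show ?thesis
      unfolding generic_locus_def by blast
  qed
  have \<kappa>: "(\<Sum>i\<in>UNIV. \<kappa> $ i) \<noteq> 1"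
  proof -
    have "(\<Sum>i\<in>UNIV. e i * \<kappa> $ i) \<noteq> 2 * of_int n + 1" if "\<forall>i. e i \<in> {1, -1}"
      for e :: "4 \<Rightarrow> complex" and n
      using assms(3) that unfolding kostov_generic_def by blast
    \<comment> \<open>All signs positive and the odd integer 1.\<close>
    from this[of "\<lambda>_. 1" 0] show ?thesis
      by simp
  qed
  have "\<exists>!m. m \<in> moduli t \<kappa> \<and> Phi t m = AutB_rel t `` {P} \<and> Upsilon t m = glue t Plus q"
    if gen: "(P, q) \<in> generic_pairs t" for P q
  proof -
    obtain p y where P: "P = affine_flags p" "q = Aff y" "y \<notin> {0, 1, t}"
      "parabolic_form t p (- y) 1 \<noteq> 0"
      using gen by (auto simp: generic_pairs_def)
    have PQ: "P \<in> Qsimple t"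
      using gen by (rule generic_pairs_simple)
    \<comment> \<open>The unique scalar for which the multiple of x - y satisfies the linear
      equation.\<close>
    define c where "c = t * (t - 1) * ((\<Sum>i\<in>UNIV. \<kappa> $ i) - 1) / 2 / parabolic_form t p (- y) 1"
    have "parabolic_form t p (c * - y) (c * 1) = t * (t - 1) * ((\<Sum>i\<in>UNIV. \<kappa> $ i) - 1) / 2"
      using P(4) unfolding parabolic_form_scale c_def by simp
    then obtain X where X: "transition X = bundleB" "flag X = affine_flags p" "X \<in> pconns t \<kappa>"
      "con0 X $ 1 $ 2 = [:c * - y, c * 1:]"
      by (rule connection_exists[OF assms(1,2)])
    note apparent = apparent_bundleB_iff[OF assms(1,2) \<kappa> P(4,3), folded c_def]
    have unique: "m = pconn_rel t \<kappa> `` {X}"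
      if m: "m \<in> moduli t \<kappa>" "Phi t m = AutB_rel t `` {P}" "Upsilon t m = glue t Plus q" for m
    proof -
      obtain X' where X': "m = pconn_rel t \<kappa> `` {X'}" "X' \<in> pconns t \<kappa>"
        using m(1) unfolding moduli_eq by (rule quotientE)
      \<comment> \<open>The value of \<open>Phi\<close> is the whole orbit of \<open>P\<close>;
        containing \<open>P\<close>, it yields an isomorphism from the standard bundle with this
        very flag.\<close>
      have "P \<in> par_class t X'"
        using m(2) equiv_class_self[OF equiv_AutB_rel PQ] unfolding X'(1) Phi_class[OF X'(2)] by simp
      then have "qp_isomorphic t bundleB P (transition X') (flag X')"
        by (simp add: par_class_def)
      then obtain Y where Y: "Y \<in> pconns t \<kappa>" "transition Y = bundleB" "flag Y = P"
        "pconn_isomorphic t Y X'"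
        using pconns_pullback[OF X'(2) is_parstr_affine_flags[of p, folded P(1)]] by blast
      have "(Y, X') \<in> pconn_rel t \<kappa>"
        using Y X'(2) by (simp add: pconn_rel_def)
      from equiv_class_eq[OF equiv_pconn_rel this] have m_eq: "m = pconn_rel t \<kappa> `` {Y}"
        unfolding X'(1) by (rule sym)
      then have "apparent t Y = glue t Plus (Aff y)"
        using m(3) Upsilon_class[OF Y(1)] P(2) by simp
      then have "con0 Y $ 1 $ 2 = smult c [:- y, 1:]"
        using apparent[OF Y(2) _ Y(1)] Y(3) P(1) by simp
      then have "Y = X"
        by (intro connection_determined[OF assms(1,2) Y(2) _ Y(1) X(1-3)])
          (simp_all add: Y(3) P(1) X(4))
      with m_eq show ?thesis
        by simp
    qed
    have "pconn_rel t \<kappa> `` {X} \<in> moduli t \<kappa>"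
      unfolding moduli_eq using X(3) by (rule quotientI)
    moreover have "Phi t (pconn_rel t \<kappa> `` {X}) = AutB_rel t `` {P}"
      using par_class_bundleB[OF X(1)] PQ X(2) P(1) by (simp add: Phi_class[OF X(3)])
    moreover have "Upsilon t (pconn_rel t \<kappa> `` {X}) = glue t Plus q"
      using apparent[OF X(1-3)] X(4) P(2) by (simp add: Upsilon_class[OF X(3)])
    ultimately show ?thesis
      by (intro ex1I conjI) (assumption+, elim conjE, rule unique)
  qed
  then show "\<forall>(p, q) \<in> generic_locus t. \<exists>!m. m \<in> moduli t \<kappa> \<and> Phi t m = p \<and> Upsilon t m = q"
    unfolding generic_locus_def by clarify
qed

end
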